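(* Let $M$ be a 2-dimensional, connected, compact, orientable smooth surface without boundary with a smooth Riemannian metric $g$, and let $f:M\to\mathbb{R}$ be a Morse function. If $N(f)\neq\emptyset$ then $M$ is the disjoint union $$M=\bigsqcup_{p\in\mathscr{M}_-(f),\ q\in\mathscr{M}_+(f)}\Omega_{p,q}(f)\ \sqcup\ N(f).$$
   Context: Let $\varphi:\mathbb{R}\times M\to M$ be the flow of $-\nabla f$: $\partial_t\varphi(t,x)=-\nabla f|_{\varphi(t,x)}$, $\varphi(0,x)=x$. For a critical point $x$ of $f$ put $W^s(x)=\{y\in M:\lim_{t\to\infty}\varphi(t,y)=x\}$ and $W^u(x)=\{y\in M:\lim_{t\to-\infty}\varphi(t,y)=x\}$. $\mathscr{S}(f)$ is the set of saddle points of $f$; $\mathscr{M}_-(f)$ and $\mathscr{M}_+(f)$ are the sets of (local) minima and maxima of $f$. For $p\in\mathscr{M}_-(f)$, $q\in\mathscr{M}_+(f)$ set $\Omega_{p,q}(f)=W^s(p)\cap W^u(q)$. The Neumann line set of $f$ is $N(f)=\overline{\bigcup_{r\in\mathscr{S}(f)}W^s(r)\cup W^u(r)}$. *)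

theory Defs
  imports "HOL-Analysis.Analysis"
begin

section \<open>Smooth maps between normed spaces\<close>

text \<open>Class \<open>C\<^sup>k\<close> on an open set, by recursion over iterated directional derivatives.
  It is only meant for open \<open>S\<close>, where the derivative at a point is unique.\<close>

primrec Ck_on :: "nat \<Rightarrow> 'a::real_normed_vector set \<Rightarrow> ('a \<Rightarrow> 'b::real_normed_vector) \<Rightarrow> bool"
  where
    "Ck_on 0 S F \<longleftrightarrow> continuous_on S F"
  | "Ck_on (Suc k) S F \<longleftrightarrow>
       (\<forall>z\<in>S. F differentiable (at z)) \<and>
       (\<forall>v. Ck_on k S (\<lambda>z. frechet_derivative F (at z) v))"

definition smooth_on :: "'a::real_normed_vector set \<Rightarrow> ('a \<Rightarrow> 'b::real_normed_vector) \<Rightarrow> bool"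
  where "smooth_on S F \<longleftrightarrow> (\<forall>k. Ck_on k S F)"


section \<open>Smooth surfaces\<close>

text \<open>A surface is a set \<open>M\<close> in a Hausdorff space with the subspace topology. A chart is a pair
  \<open>(U, \<psi>)\<close>; the values of \<open>\<psi>\<close> outside \<open>U\<close> are irrelevant. Second countability is not demanded
  separately, because it follows from compactness of \<open>M\<close>. Charts map onto open subsets of
  the plane, so there is no boundary.\<close>

type_synonym 'a chart = "'a set \<times> ('a \<Rightarrow> real^2)"

abbreviation chart_dom :: "'a chart \<Rightarrow> 'a set" where
  "chart_dom c \<equiv> fst c"

abbreviation coord :: "'a chart \<Rightarrow> 'a \<Rightarrow> real^2" where
  "coord c \<equiv> snd c"

abbreviation chart_ran :: "'a chart \<Rightarrow> (real^2) set" where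
  "chart_ran c \<equiv> coord c ` chart_dom c"

definition param :: "'a chart \<Rightarrow> real^2 \<Rightarrow> 'a" where
  "param c = inv_into (chart_dom c) (coord c)"

definition is_chart :: "'a::topological_space set \<Rightarrow> 'a chart \<Rightarrow> bool" where
  "is_chart M c \<longleftrightarrow>
     openin (top_of_set M) (chart_dom c) \<and> open (chart_ran c) \<and>
     homeomorphism (chart_dom c) (chart_ran c) (coord c) (param c)"

definition transition :: "'a chart \<Rightarrow> 'a chart \<Rightarrow> real^2 \<Rightarrow> real^2" where
  "transition c d = coord d \<circ> param c"

definition smooth_atlas :: "'a::topological_space set \<Rightarrow> 'a chart set \<Rightarrow> bool" where
  "smooth_atlas M A \<longleftrightarrow>
     (\<forall>c\<in>A. is_chart M c) \<and> (\<Union>c\<in>A. chart_dom c) = M \<and>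
     (\<forall>c\<in>A. \<forall>d\<in>A. smooth_on (coord c ` (chart_dom c \<inter> chart_dom d)) (transition c d))"

definition transition_jacobian :: "'a chart \<Rightarrow> 'a chart \<Rightarrow> 'a \<Rightarrow> real^2^2" where
  "transition_jacobian c d x = jacobian (transition c d) (at (coord c x))"

text \<open>\<open>A\<close> need not be maximal, so an oriented atlas \<open>B\<close> is sought among all atlases defining the
  same smooth structure, that is, those for which \<open>A \<union> B\<close> is again a smooth atlas.\<close>

definition orientable :: "'a::topological_space set \<Rightarrow> 'a chart set \<Rightarrow> bool" where
  "orientable M A \<longleftrightarrow>
     (\<exists>B. smooth_atlas M B \<and> smooth_atlas M (A \<union> B) \<and>
       (\<forall>c\<in>B. \<forall>d\<in>B. \<forall>x\<in>chart_dom c \<inter> chart_dom d. det (transition_jacobian c d x) > 0))"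


section \<open>Riemannian metrics and gradients\<close>

text \<open>A metric is given by its components: \<open>g c x\<close> is the matrix \<open>(g\<^sub>i\<^sub>j)\<close> at the point \<open>x\<close> with
  respect to the coordinates of the chart \<open>c\<close>. The last clause is the transformation law of a
  covariant 2-tensor.\<close>

type_synonym 'a metric = "'a chart \<Rightarrow> 'a \<Rightarrow> real^2^2"

definition riemannian_metric :: "'a chart set \<Rightarrow> 'a metric \<Rightarrow> bool" where
  "riemannian_metric A g \<longleftrightarrow>
     (\<forall>c\<in>A. smooth_on (chart_ran c) (g c \<circ> param c)) \<and>
     (\<forall>c\<in>A. \<forall>x\<in>chart_dom c.
        transpose (g c x) = g c x \<and> (\<forall>v. v \<noteq> 0 \<longrightarrow> v \<bullet> (g c x *v v) > 0)) \<and>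
     (\<forall>c\<in>A. \<forall>d\<in>A. \<forall>x\<in>chart_dom c \<inter> chart_dom d.
        g c x = transpose (transition_jacobian c d x) ** g d x ** transition_jacobian c d x)"

definition partials :: "(real^2 \<Rightarrow> real) \<Rightarrow> real^2 \<Rightarrow> real^2" where
  "partials F z = (\<chi> i. frechet_derivative F (at z) (axis i 1))"

text \<open>In coordinates, \<open>(\<nabla>f)\<^sup>i = g\<^sup>i\<^sup>j \<partial>\<^sub>j f\<close>.\<close>

definition gradient :: "'a metric \<Rightarrow> ('a \<Rightarrow> real) \<Rightarrow> 'a chart \<Rightarrow> 'a \<Rightarrow> real^2" where
  "gradient g f c x = matrix_inv (g c x) *v partials (f \<circ> param c) (coord c x)"


section \<open>Morse functions\<close>

definition smooth_function :: "'a chart set \<Rightarrow> ('a \<Rightarrow> real) \<Rightarrow> bool" where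
  "smooth_function A f \<longleftrightarrow> (\<forall>c\<in>A. smooth_on (chart_ran c) (f \<circ> param c))"

definition critical_points :: "'a set \<Rightarrow> 'a chart set \<Rightarrow> ('a \<Rightarrow> real) \<Rightarrow> 'a set" where
  "critical_points M A f =
     {x \<in> M. \<forall>c\<in>A. x \<in> chart_dom c \<longrightarrow>
        frechet_derivative (f \<circ> param c) (at (coord c x)) = (\<lambda>v. 0)}"

definition hessian :: "('a \<Rightarrow> real) \<Rightarrow> 'a chart \<Rightarrow> 'a \<Rightarrow> real^2^2" where
  "hessian f c x = jacobian (partials (f \<circ> param c)) (at (coord c x))"

definition morse_function :: "'a set \<Rightarrow> 'a chart set \<Rightarrow> ('a \<Rightarrow> real) \<Rightarrow> bool" where
  "morse_function M A f \<longleftrightarrow>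
     smooth_function A f \<and>
     (\<forall>x\<in>critical_points M A f. \<forall>c\<in>A. x \<in> chart_dom c \<longrightarrow> det (hessian f c x) \<noteq> 0)"

definition is_eigenvalue :: "real^'n^'n \<Rightarrow> real \<Rightarrow> bool" where
  "is_eigenvalue H l \<longleftrightarrow> (\<exists>v. v \<noteq> 0 \<and> H *v v = l *\<^sub>R v)"

text \<open>A saddle point of a Morse function is a critical point of Morse index 1. At a critical
  point a change of chart replaces the Hessian matrix by a congruent one, so the signs of its
  eigenvalues do not depend on the chart.\<close>

definition saddles :: "'a set \<Rightarrow> 'a chart set \<Rightarrow> ('a \<Rightarrow> real) \<Rightarrow> 'a set" where
  "saddles M A f =
     {x \<in> critical_points M A f. \<forall>c\<in>A. x \<in> chart_dom c \<longrightarrow>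
        (\<exists>l<0. is_eigenvalue (hessian f c x) l) \<and> (\<exists>l>0. is_eigenvalue (hessian f c x) l)}"

definition local_minima :: "'a::topological_space set \<Rightarrow> ('a \<Rightarrow> real) \<Rightarrow> 'a set" where
  "local_minima M f = {x \<in> M. \<exists>U. openin (top_of_set M) U \<and> x \<in> U \<and> (\<forall>y\<in>U. f x \<le> f y)}"

definition local_maxima :: "'a::topological_space set \<Rightarrow> ('a \<Rightarrow> real) \<Rightarrow> 'a set" where
  "local_maxima M f = {x \<in> M. \<exists>U. openin (top_of_set M) U \<and> x \<in> U \<and> (\<forall>y\<in>U. f y \<le> f x)}"


section \<open>The gradient flow and the Neumann line set\<close>

text \<open>The curve \<open>\<lambda>t. \<phi> t x\<close> solves \<open>\<partial>\<^sub>t \<phi> = - \<nabla>f\<close>, an equation between coordinate vectors in every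
  chart. Continuity of the curve, part of its differentiability as a map into \<open>M\<close>, ensures
  that it stays in the chart domain for times near \<open>t\<close>.\<close>

definition neg_gradient_flow ::
  "'a::topological_space set \<Rightarrow> 'a chart set \<Rightarrow> 'a metric \<Rightarrow> ('a \<Rightarrow> real) \<Rightarrow> (real \<Rightarrow> 'a \<Rightarrow> 'a) \<Rightarrow> bool"
  where
  "neg_gradient_flow M A g f \<phi> \<longleftrightarrow>
     (\<forall>x\<in>M. \<phi> 0 x = x \<and> (\<forall>t. \<phi> t x \<in> M) \<and> continuous_on UNIV (\<lambda>t. \<phi> t x) \<and>
       (\<forall>t. \<forall>c\<in>A. \<phi> t x \<in> chart_dom c \<longrightarrow>
          ((\<lambda>s. coord c (\<phi> s x)) has_vector_derivative - gradient g f c (\<phi> t x)) (at t)))"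

definition stable_set :: "'a::topological_space set \<Rightarrow> (real \<Rightarrow> 'a \<Rightarrow> 'a) \<Rightarrow> 'a \<Rightarrow> 'a set" where
  "stable_set M \<phi> x = {y \<in> M. ((\<lambda>t. \<phi> t y) \<longlongrightarrow> x) at_top}"

definition unstable_set :: "'a::topological_space set \<Rightarrow> (real \<Rightarrow> 'a \<Rightarrow> 'a) \<Rightarrow> 'a \<Rightarrow> 'a set" where
  "unstable_set M \<phi> x = {y \<in> M. ((\<lambda>t. \<phi> t y) \<longlongrightarrow> x) at_bot}"

definition neumann_domain ::
  "'a::topological_space set \<Rightarrow> (real \<Rightarrow> 'a \<Rightarrow> 'a) \<Rightarrow> 'a \<Rightarrow> 'a \<Rightarrow> 'a set" where
  "neumann_domain M \<phi> p q = stable_set M \<phi> p \<inter> unstable_set M \<phi> q"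

definition neumann_lines ::
  "'a::topological_space set \<Rightarrow> 'a chart set \<Rightarrow> ('a \<Rightarrow> real) \<Rightarrow> (real \<Rightarrow> 'a \<Rightarrow> 'a) \<Rightarrow> 'a set" where
  "neumann_lines M A f \<phi> =
     M \<inter> closure (\<Union>r\<in>saddles M A f. stable_set M \<phi> r \<union> unstable_set M \<phi> r)"

end

theory Submission
  imports Defs
begin

text \<open>Along the flow \<open>f\<close> decreases, critical points are isolated, and so every orbit converges in
  both time directions to critical points, each of which is a minimum, a maximum or a saddle. An orbit
  not tied to a saddle thus either lies in some \<open>\<Omega>\<^bsub>p,q\<^esub>\<close> or is a constant orbit at an extremum. Since
  the stable set of a minimum and the unstable set of a maximum are open, \<open>\<Omega>\<^bsub>p,q\<^esub>\<close> is open and does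
  not meet the closure of the lines of the saddles.

  It remains to show that each extremum lies in the Neumann line set once there is a saddle. If a
  maximum \<open>q\<close> had a neighbourhood without points of stable lines of saddles, all orbits in a small
  punctured disc around \<open>q\<close> would end in minima, and by connectedness in the same minimum \<open>p\<close>. Then
  \<open>W\<^sup>u(q)\<close> is open and closed in the connected set \<open>M - {p}\<close>, hence equal to it, which leaves no room
  for a saddle. Minima are maxima of \<open>-f\<close> for the reversed flow.\<close>

section \<open>Smooth functions and Lipschitz vector fields\<close>

text \<open>The flow is given only as a family of curves, one through each point, that solve the
  equation in charts. Its group law and its continuity in the starting point have to be earned: the
  gradient is locally Lipschitz in coordinates, so Gronwall's inequality controls the divergence of
  orbits. Everything global is then purely topological and takes place in
  \<open>gradient_like_flow\<close>, where only a continuous flow, a strictly decreasing function,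
  finitely many rest points and connected punctured discs are left. No normal form and no invariant
  manifold at a saddle is used: a saddle enters only as a rest point that is no extremum. The Morse
  condition is translated into this language through the sign of the determinant of a 2 by 2
  Hessian. The delicate step is that the unstable set of a maximum is closed in
  \<open>M - {p}\<close>. A compact shell around the maximum is swept into any given neighbourhood
  of \<open>p\<close> in a uniform time, which leaves only a compact part of the unstable set
  outside that neighbourhood.\<close>

lemma smooth_on_differentiable: "smooth_on S F \<Longrightarrow> z \<in> S \<Longrightarrow> F differentiable (at z)"
  unfolding smooth_on_def by (metis Ck_on.simps(2))

lemma smooth_on_frechet_derivative:
  "smooth_on S F \<Longrightarrow> smooth_on S (\<lambda>z. frechet_derivative F (at z) v)"
  unfolding smooth_on_def by (metis Ck_on.simps(2))

lemma smooth_on_continuous_on: "smooth_on S F \<Longrightarrow> continuous_on S F"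
  unfolding smooth_on_def by (metis Ck_on.simps(1))

text \<open>The directional derivatives along the basis are continuous, hence bounded on the compact
  \<open>K\<close>; convexity turns the resulting bound on the operator norm into a Lipschitz
  constant.\<close>

lemma smooth_on_lipschitz_on:
  fixes F :: "'a::euclidean_space \<Rightarrow> 'b::real_normed_vector"
  assumes F: "smooth_on S F" and K: "compact K" "convex K" "K \<subseteq> S"
  obtains L where "L-lipschitz_on K F"
proof -
  let ?D = "\<lambda>z. frechet_derivative F (at z)"
  have "\<exists>B. \<forall>z\<in>K. norm (?D z b) \<le> B" for b
  proof -
    have "continuous_on K (\<lambda>z. ?D z b)"
      using smooth_on_continuous_on[OF smooth_on_frechet_derivative[OF F]] K(3)
      by (rule continuous_on_subset)
    then have "bounded ((\<lambda>z. ?D z b) ` K)"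
      using K(1) by (intro compact_imp_bounded compact_continuous_image)
    then show ?thesis by (auto simp: bounded_iff)
  qed
  then obtain B where B: "\<And>b z. z \<in> K \<Longrightarrow> norm (?D z b) \<le> B b" by metis
  \<comment> \<open>The \<open>max 0\<close> covers an empty \<open>K\<close>, for which the bounds
    \<open>B b\<close> are arbitrary numbers.\<close>
  define L where "L = max 0 (\<Sum>b\<in>Basis. B b)"
  have D: "(F has_derivative ?D z) (at z)" if "z \<in> K" for z
    using smooth_on_differentiable[OF F] K(3) that by (auto simp: frechet_derivative_works[symmetric])
  have oL: "onorm (?D z) \<le> L" if z: "z \<in> K" for z
  proof (rule onorm_bound)
    show "0 \<le> L" by (simp add: L_def)
    fix h :: 'a
    have lin: "linear (?D z)" using D[OF z] by (rule has_derivative_linear)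
    have "?D z h = ?D z (\<Sum>b\<in>Basis. (h \<bullet> b) *\<^sub>R b)" by (simp add: euclidean_representation)
    also have "\<dots> = (\<Sum>b\<in>Basis. (h \<bullet> b) *\<^sub>R ?D z b)"
      using lin by (simp add: linear_sum linear_scale)
    also have "norm \<dots> \<le> (\<Sum>b\<in>Basis. norm h * B b)"
      using B[OF z] by (intro sum_norm_le) (auto intro!: mult_mono Basis_le_norm)
    also have "\<dots> = norm h * (\<Sum>b\<in>Basis. B b)" by (simp add: sum_distrib_left)
    also have "\<dots> \<le> L * norm h" unfolding L_def mult.commute[of _ "norm h"] by (intro mult_left_mono) auto
    finally show "norm (?D z h) \<le> L * norm h" .
  qed
  have "L-lipschitz_on K F"
  proof (rule lipschitz_onI)
    fix x y assume "x \<in> K" "y \<in> K"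
    then show "dist (F x) (F y) \<le> L * dist x y"
      using differentiable_bound[OF K(2) has_derivative_at_withinI[OF D] oL] by (simp add: dist_norm)
  qed (simp add: L_def)
  then show thesis by (rule that)
qed

section \<open>Linear systems with positive definite matrices\<close>

lemma norm_matrix_vector_mult_le:
  fixes A :: "real^'n^'m"
  shows "norm (A *v x) \<le> real CARD('m) * norm A * norm x"
proof -
  have "norm (A *v x) \<le> (\<Sum>i\<in>UNIV. \<bar>(A *v x) $ i\<bar>)" by (rule norm_le_l1_cart)
  also have "\<dots> \<le> (\<Sum>i\<in>(UNIV::'m set). norm A * norm x)"
  proof (rule sum_mono)
    fix i
    have "\<bar>(A *v x) $ i\<bar> \<le> norm (A $ i) * norm x"
      by (simp add: matrix_vector_mul_component Cauchy_Schwarz_ineq2)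
    also have "\<dots> \<le> norm A * norm x" by (intro mult_right_mono Finite_Cartesian_Product.norm_nth_le) simp
    finally show "\<bar>(A *v x) $ i\<bar> \<le> norm A * norm x" .
  qed
  also have "\<dots> = real CARD('m) * norm A * norm x" by simp
  finally show ?thesis .
qed

text \<open>The quadratic form attains a positive minimum on the compact product of \<open>K\<close>
  with the unit sphere, and homogeneity extends the bound to all vectors.\<close>

lemma uniformly_coercive:
  fixes G :: "'z::topological_space \<Rightarrow> real^'n^'n"
  assumes K: "compact K" and G: "continuous_on K G"
    and pos: "\<And>z v. z \<in> K \<Longrightarrow> v \<noteq> 0 \<Longrightarrow> v \<bullet> (G z *v v) > 0"
  obtains l where "l > 0" "\<And>z v. z \<in> K \<Longrightarrow> l * (norm v)\<^sup>2 \<le> v \<bullet> (G z *v v)"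
proof (cases "K = {}")
  case True
  then show thesis using that[of 1] by simp
next
  case False
  let ?S = "sphere (0::real^'n) 1"
  let ?h = "\<lambda>(z, v). v \<bullet> (G z *v v)"
  have "?S \<noteq> {}" by (simp add: sphere_eq_empty)
  have "continuous_on (K \<times> ?S) (\<lambda>x. snd x \<bullet> (G (fst x) *v snd x))"
    unfolding matrix_vector_mult_def
    by (intro continuous_intros continuous_on_compose2[OF G]) auto
  then have "continuous_on (K \<times> ?S) ?h" by (simp add: case_prod_beta')
  then obtain z0 v0 where z0: "z0 \<in> K" "v0 \<in> ?S" "\<And>z v. z \<in> K \<Longrightarrow> v \<in> ?S \<Longrightarrow> ?h (z0, v0) \<le> ?h (z, v)"
    using continuous_attains_inf[of "K \<times> ?S" ?h] False \<open>?S \<noteq> {}\<close> compact_Times[OF K, of ?S]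
    by (fastforce simp: compact_sphere)
  let ?l = "?h (z0, v0)"
  show thesis
  proof
    have "v0 \<noteq> 0" using z0(2) by auto
    then show "?l > 0" using z0(1) pos by simp
    fix z v assume z: "z \<in> K"
    show "?l * (norm v)\<^sup>2 \<le> v \<bullet> (G z *v v)"
    proof (cases "v = 0")
      case False
      define w where "w = (1 / norm v) *\<^sub>R v"
      have "w \<in> ?S" using False by (simp add: w_def)
      then have "?l \<le> w \<bullet> (G z *v w)" using z0(3)[OF z] by simp
      then have "?l * (norm v)\<^sup>2 \<le> (w \<bullet> (G z *v w)) * (norm v)\<^sup>2" by (rule mult_right_mono) simp
      also have "\<dots> = (norm v *\<^sub>R w) \<bullet> (G z *v (norm v *\<^sub>R w))"
        by (simp add: matrix_vector_mult_scaleR power2_eq_square)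
      also have "norm v *\<^sub>R w = v" using False by (simp add: w_def)
      finally show ?thesis .
    qed simp
  qed
qed

text \<open>The difference of two solutions is tested against the matrix of the first system, so no
  formula for the inverse matrix is needed.\<close>

lemma lipschitz_on_solution:
  fixes G :: "'z::metric_space \<Rightarrow> real^'n^'n" and p X :: "'z \<Rightarrow> real^'n"
  assumes K: "compact K" and G: "LG-lipschitz_on K G" and p: "Lp-lipschitz_on K p"
    and pos: "\<And>z v. z \<in> K \<Longrightarrow> v \<noteq> 0 \<Longrightarrow> v \<bullet> (G z *v v) > 0"
    and X: "\<And>z. z \<in> K \<Longrightarrow> G z *v X z = p z"
  obtains L where "L-lipschitz_on K X"
proof -
  have contG: "continuous_on K G" and contp: "continuous_on K p"
    using G p lipschitz_on_continuous_on by blast+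
  obtain l where l: "l > 0" "\<And>z v. z \<in> K \<Longrightarrow> l * (norm v)\<^sup>2 \<le> v \<bullet> (G z *v v)"
    using uniformly_coercive[OF K contG pos] by blast
  have bound: "norm v \<le> norm (G z *v v) / l" if "z \<in> K" for z v
  proof (cases "v = 0")
    case False
    have "l * (norm v)\<^sup>2 \<le> norm v * norm (G z *v v)"
      using l(2)[OF that, of v] norm_cauchy_schwarz[of v "G z *v v"] by linarith
    then have "norm v * (l * norm v) \<le> norm v * norm (G z *v v)"
      by (simp add: power2_eq_square algebra_simps)
    then have "l * norm v \<le> norm (G z *v v)" using False by simp
    then show ?thesis using l(1) by (simp add: field_simps)
  qed (use l in simp)
  have "bounded (p ` K)" using contp K by (intro compact_imp_bounded compact_continuous_image)
  then obtain b where b: "\<And>z. z \<in> K \<Longrightarrow> norm (p z) \<le> b" by (auto simp: bounded_iff)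
  define B where "B = max 0 (b / l)"
  have XB: "norm (X z) \<le> B" if "z \<in> K" for z
  proof -
    have "norm (X z) \<le> norm (p z) / l" using bound[OF that, of "X z"] X[OF that] by simp
    also have "\<dots> \<le> b / l" using b[OF that] l(1) by (simp add: divide_right_mono)
    finally show ?thesis by (simp add: B_def)
  qed
  \<comment> \<open>\<open>Lp\<close> pays for the increment of \<open>p\<close>, the second summand
    for the increment of \<open>G\<close> applied to a solution of norm at most \<open>B\<close>;
    dividing by \<open>l\<close> undoes \<open>G z\<close>.\<close>
  define L where "L = (Lp + real CARD('n) * LG * B) / l"
  have "L \<ge> 0"
    using lipschitz_on_nonneg[OF G] lipschitz_on_nonneg[OF p] l(1) by (simp add: L_def B_def)
  have "L-lipschitz_on K X"
  proof (rule lipschitz_onI)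
    fix z w assume zw: "z \<in> K" "w \<in> K"
    have "G z *v (X z - X w) = (p z - p w) - (G z - G w) *v X w"
      using X zw by (simp add: matrix_vector_mult_diff_distrib matrix_vector_mult_diff_rdistrib)
    then have "norm (G z *v (X z - X w)) \<le> norm (p z - p w) + norm ((G z - G w) *v X w)"
      by (metis norm_triangle_ineq4)
    also have "norm ((G z - G w) *v X w) \<le> real CARD('n) * norm (G z - G w) * norm (X w)"
      by (rule norm_matrix_vector_mult_le)
    also have "\<dots> \<le> real CARD('n) * (LG * dist z w) * B"
      using lipschitz_onD[OF G zw] XB[OF zw(2)] lipschitz_on_nonneg[OF G]
      by (intro mult_mono) (auto simp: dist_norm[symmetric])
    also have "norm (p z - p w) \<le> Lp * dist z w"
      using lipschitz_onD[OF p zw] by (simp add: dist_norm)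
    finally have "norm (G z *v (X z - X w)) \<le> (Lp + real CARD('n) * LG * B) * dist z w"
      by (simp add: algebra_simps)
    then have "norm (G z *v (X z - X w)) / l \<le> L * dist z w"
      using l(1) by (simp add: L_def divide_right_mono)
    then show "dist (X z) (X w) \<le> L * dist z w"
      using bound[OF zw(1), of "X z - X w"] by (simp add: dist_norm)
  qed fact
  then show thesis by (rule that)
qed

text \<open>Gronwall's inequality for the squared distance: multiplied by
  \<open>exp (- 2 * L * t)\<close> it has nonpositive derivative, because the Lipschitz bound
  controls the inner product of the difference with its velocity.\<close>

lemma lipschitz_solutions_diverge_exponentially:
  fixes u v :: "real \<Rightarrow> 'a::real_inner"
  assumes T: "0 \<le> T" and X: "L-lipschitz_on K X"
    and u: "\<And>t. 0 \<le> t \<Longrightarrow> t \<le> T \<Longrightarrow> u t \<in> K"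
      "\<And>t. 0 \<le> t \<Longrightarrow> t \<le> T \<Longrightarrow> (u has_vector_derivative X (u t)) (at t)"
    and v: "\<And>t. 0 \<le> t \<Longrightarrow> t \<le> T \<Longrightarrow> v t \<in> K"
      "\<And>t. 0 \<le> t \<Longrightarrow> t \<le> T \<Longrightarrow> (v has_vector_derivative X (v t)) (at t)"
  shows "norm (u T - v T) \<le> exp (L * T) * norm (u 0 - v 0)"
proof -
  define h where "h t = ((u t - v t) \<bullet> (u t - v t)) * exp (- (2 * L) * t)" for t
  have "h T \<le> h 0"
  proof (rule DERIV_nonpos_imp_nonincreasing[OF T])
    fix t assume t: "0 \<le> t" "t \<le> T"
    let ?w = "u t - v t" and ?d = "X (u t) - X (v t)"
    have "((\<lambda>t. u t - v t) has_vector_derivative ?d) (at t)"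
      using u(2)[OF t] v(2)[OF t] by (rule has_vector_derivative_diff)
    then have D: "((\<lambda>t. u t - v t) has_derivative (\<lambda>s. s *\<^sub>R ?d)) (at t)"
      by (simp add: has_vector_derivative_def)
    have "(\<lambda>s. ?w \<bullet> (s *\<^sub>R ?d) + (s *\<^sub>R ?d) \<bullet> ?w) = (*) (2 * (?w \<bullet> ?d))"
      by (rule ext) (simp add: inner_commute[of _ ?w])
    with has_derivative_inner[OF D D]
    have "((\<lambda>t. (u t - v t) \<bullet> (u t - v t)) has_real_derivative 2 * (?w \<bullet> ?d)) (at t)"
      unfolding has_field_derivative_def by simp
    then have "DERIV h t :> (2 * (?w \<bullet> ?d)) * exp (- (2 * L) * t)
        + (?w \<bullet> ?w) * (exp (- (2 * L) * t) * (- (2 * L)))"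
      unfolding h_def by (auto intro!: derivative_eq_intros)
    moreover have "?w \<bullet> ?d \<le> L * (?w \<bullet> ?w)"
    proof -
      have "?w \<bullet> ?d \<le> norm ?w * norm ?d" by (rule norm_cauchy_schwarz)
      also have "\<dots> \<le> norm ?w * (L * norm ?w)"
        using lipschitz_onD[OF X u(1)[OF t] v(1)[OF t]] by (intro mult_left_mono) (auto simp: dist_norm)
      finally show ?thesis by (simp add: dot_square_norm power2_eq_square algebra_simps)
    qed
    then have "(2 * (?w \<bullet> ?d) - 2 * L * (?w \<bullet> ?w)) * exp (- (2 * L) * t) \<le> 0"
      by (intro mult_nonpos_nonneg) auto
    ultimately show "\<exists>y. DERIV h t :> y \<and> y \<le> 0"
      by (intro exI conjI) (assumption, simp add: algebra_simps)
  qed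
  then have "(norm (u T - v T))\<^sup>2 * exp (- (2 * L) * T) \<le> (norm (u 0 - v 0))\<^sup>2"
    by (simp add: h_def dot_square_norm)
  then have "(norm (u T - v T))\<^sup>2 \<le> exp (2 * L * T) * (norm (u 0 - v 0))\<^sup>2"
    by (simp add: exp_minus field_simps)
  also have "\<dots> = (exp (L * T) * norm (u 0 - v 0))\<^sup>2"
    by (simp add: power_mult_distrib exp_double[symmetric] mult.assoc)
  finally show ?thesis by (rule power2_le_imp_le) simp
qed

section \<open>Critical points of functions of several variables\<close>

lemma DERIV_along_line:
  fixes F :: "'a::real_inner \<Rightarrow> real"
  assumes "(F has_derivative (\<lambda>h. P \<bullet> h)) (at (a + t *\<^sub>R u))"
  shows "DERIV (\<lambda>t. F (a + t *\<^sub>R u)) t :> P \<bullet> u"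
proof -
  have "((\<lambda>t. a + t *\<^sub>R u) has_derivative (\<lambda>s. s *\<^sub>R u)) (at t)"
    by (auto intro!: derivative_eq_intros)
  from has_derivative_compose[OF this assms]
  have "((\<lambda>t. F (a + t *\<^sub>R u)) has_derivative (\<lambda>s. P \<bullet> (s *\<^sub>R u))) (at t)" .
  moreover have "(\<lambda>s. P \<bullet> (s *\<^sub>R u)) = (*) (P \<bullet> u)" by (simp add: fun_eq_iff)
  ultimately show ?thesis unfolding has_field_derivative_def by simp
qed

text \<open>Differentiability of the gradient \<open>p\<close> at the single point \<open>z\<close>
  suffices. The second difference on the left is symmetric in \<open>u\<close> and \<open>v\<close>,
  which is what makes the estimate useful.\<close>

lemma second_difference_quotient:
  fixes F :: "'a::real_inner \<Rightarrow> real"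
  assumes S: "open S" "z \<in> S" and F: "\<And>w. w \<in> S \<Longrightarrow> (F has_derivative (\<lambda>h. p w \<bullet> h)) (at w)"
    and p: "(p has_derivative H) (at z)" and e: "e > 0"
  obtains d where "d > 0" "\<And>t. 0 < t \<Longrightarrow> t < d \<Longrightarrow>
    \<bar>F (z + t *\<^sub>R v + t *\<^sub>R u) - F (z + t *\<^sub>R u) - F (z + t *\<^sub>R v) + F z - t\<^sup>2 * (H v \<bullet> u)\<bar> \<le> e * t\<^sup>2"
proof -
  interpret H: bounded_linear H using p by (rule has_derivative_bounded_linear)
  \<comment> \<open>The factor by which the two remainders \<open>R1\<close> and \<open>R2\<close>,
    paired with \<open>u\<close>, exceed the accuracy of the expansion of \<open>p\<close>; the
    \<open>+ 1\<close> keeps it positive.\<close>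
  define c where "c = (2 * norm u + norm v) * norm u + 1"
  have c: "c > 0" unfolding c_def by (rule add_nonneg_pos) simp_all
  obtain r where r: "r > 0" "ball z r \<subseteq> S" using S open_contains_ball by blast
  obtain d1 where d1: "d1 > 0" "\<And>y. norm (y - z) < d1 \<Longrightarrow>
      norm (p y - p z - H (y - z)) \<le> e / c * norm (y - z)"
    using p e c unfolding has_derivative_at_alt by (metis divide_pos_pos)
  define d where "d = min r d1 / (norm u + norm v + 1)"
  have nuv: "norm u + norm v + 1 > 0" by (simp add: add_nonneg_pos)
  show thesis
  proof
    show "d > 0" using r d1 nuv by (simp add: d_def)
    fix t :: real assume t: "0 < t" "t < d"
    have "t * (norm u + norm v + 1) < min r d1"
      using t(2) nuv unfolding d_def by (simp add: pos_less_divide_eq)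
    then have small: "t * (norm u + norm v) < r" "t * (norm u + norm v) < d1"
      using t by (auto simp: algebra_simps)
    have near: "norm (a *\<^sub>R v + s *\<^sub>R u) \<le> t * (norm u + norm v)"
      if "0 \<le> s" "s \<le> t" "0 \<le> a" "a \<le> t" for s a
    proof -
      have "norm (a *\<^sub>R v + s *\<^sub>R u) \<le> a * norm v + s * norm u"
        using norm_triangle_ineq[of "a *\<^sub>R v" "s *\<^sub>R u"] that by simp
      also have "\<dots> \<le> t * norm v + t * norm u" using that by (intro add_mono mult_right_mono) auto
      finally show ?thesis by (simp add: algebra_simps)
    qed
    have inS: "z + a *\<^sub>R v + s *\<^sub>R u \<in> S" if "0 \<le> s" "s \<le> t" "0 \<le> a" "a \<le> t" for s a
    proof -
      have "dist z (z + a *\<^sub>R v + s *\<^sub>R u) = norm (a *\<^sub>R v + s *\<^sub>R u)"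
        unfolding dist_norm by (metis add.assoc add_diff_cancel_left' norm_minus_commute)
      then have "dist z (z + a *\<^sub>R v + s *\<^sub>R u) < r" using near[OF that] small by linarith
      then show ?thesis using r(2) by auto
    qed
    \<comment> \<open>The increment in direction \<open>v\<close>, seen as a function of the
      displacement along \<open>u\<close>. Its derivative is a difference of two values of
      \<open>p\<close>, and both can be expanded at \<open>z\<close>.\<close>
    define k where "k s = F ((z + t *\<^sub>R v) + s *\<^sub>R u) - F (z + s *\<^sub>R u)" for s
    have "\<exists>s. 0 < s \<and> s < t \<and> k t - k 0 = (t - 0) *
        (p (z + t *\<^sub>R v + s *\<^sub>R u) \<bullet> u - p (z + s *\<^sub>R u) \<bullet> u)"
    proof (rule MVT2[OF t(1)])
      fix s assume s: "0 \<le> s" "s \<le> t"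
      show "DERIV k s :> p (z + t *\<^sub>R v + s *\<^sub>R u) \<bullet> u - p (z + s *\<^sub>R u) \<bullet> u"
        unfolding k_def using inS[of s t] inS[of s 0] s t(1)
        by (intro DERIV_diff DERIV_along_line F) auto
    qed
    then obtain s where s: "0 < s" "s < t" "k t - k 0 = t *
        (p (z + t *\<^sub>R v + s *\<^sub>R u) \<bullet> u - p (z + s *\<^sub>R u) \<bullet> u)" by auto
    define R1 where "R1 = p (z + t *\<^sub>R v + s *\<^sub>R u) - p z - H (t *\<^sub>R v + s *\<^sub>R u)"
    define R2 where "R2 = p (z + s *\<^sub>R u) - p z - H (s *\<^sub>R u)"
    have "norm R1 \<le> e / c * norm (t *\<^sub>R v + s *\<^sub>R u)"
      unfolding R1_def using d1(2)[of "z + t *\<^sub>R v + s *\<^sub>R u"] near[of s t] small s t by (simp add: add.assoc)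
    also have "\<dots> \<le> e / c * (t * (norm u + norm v))"
      using near[of s t] s t e c by (intro mult_left_mono) auto
    finally have R1: "norm R1 \<le> e / c * (t * (norm u + norm v))" .
    have su: "norm (s *\<^sub>R u) \<le> t * norm u" using s t by (simp add: mult_right_mono)
    have "norm R2 \<le> e / c * norm (s *\<^sub>R u)"
      unfolding R2_def using d1(2)[of "z + s *\<^sub>R u"] near[of s 0] small s t by simp
    also have "\<dots> \<le> e / c * (t * norm u)"
      using su e c by (intro mult_left_mono) auto
    finally have R2: "norm R2 \<le> e / c * (t * norm u)" .
    have "k t - k 0 = t * ((R1 - R2) \<bullet> u + t * (H v \<bullet> u))"
      unfolding s(3) R1_def R2_def H.add H.scaleR by (simp add: inner_diff_left inner_add_left)
    then have "k t - k 0 - t\<^sup>2 * (H v \<bullet> u) = t * ((R1 - R2) \<bullet> u)"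
      by (simp add: power2_eq_square algebra_simps)
    then have "\<bar>k t - k 0 - t\<^sup>2 * (H v \<bullet> u)\<bar> = t * \<bar>(R1 - R2) \<bullet> u\<bar>"
      using t by (simp add: abs_mult)
    also have "\<dots> \<le> t * ((e / c * (t * (norm u + norm v)) + e / c * (t * norm u)) * norm u)"
    proof (rule mult_left_mono)
      have "\<bar>(R1 - R2) \<bullet> u\<bar> \<le> norm (R1 - R2) * norm u" by (rule Cauchy_Schwarz_ineq2)
      also have "\<dots> \<le> (e / c * (t * (norm u + norm v)) + e / c * (t * norm u)) * norm u"
        using norm_triangle_ineq4[of R1 R2] R1 R2 by (intro mult_right_mono) auto
      finally show "\<bar>(R1 - R2) \<bullet> u\<bar> \<le> (e / c * (t * (norm u + norm v)) + e / c * (t * norm u)) * norm u" .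
    qed (use t in simp)
    also have "\<dots> = e * t\<^sup>2 * ((c - 1) / c)"
      by (simp add: c_def power2_eq_square algebra_simps add_divide_distrib)
    also have "\<dots> \<le> e * t\<^sup>2 * 1" using c e by (intro mult_left_mono) auto
    finally show "\<bar>F (z + t *\<^sub>R v + t *\<^sub>R u) - F (z + t *\<^sub>R u) - F (z + t *\<^sub>R v) + F z - t\<^sup>2 * (H v \<bullet> u)\<bar> \<le> e * t\<^sup>2"
      by (simp add: k_def algebra_simps)
  qed
qed

text \<open>Schwarz's theorem: one and the same second difference is approximated by both bilinear
  expressions, up to an arbitrarily small multiple of \<open>t^2\<close>.\<close>

lemma second_derivative_symmetric:
  fixes F :: "'a::real_inner \<Rightarrow> real"
  assumes S: "open S" "z \<in> S" and F: "\<And>w. w \<in> S \<Longrightarrow> (F has_derivative (\<lambda>h. p w \<bullet> h)) (at w)"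
    and p: "(p has_derivative H) (at z)"
  shows "H v \<bullet> u = H u \<bullet> v"
proof (rule ccontr)
  assume "H v \<bullet> u \<noteq> H u \<bullet> v"
  \<comment> \<open>Two errors of size \<open>e * t^2\<close> cannot bridge a gap of
    \<open>4 * e * t^2\<close>.\<close>
  define e where "e = \<bar>H v \<bullet> u - H u \<bullet> v\<bar> / 4"
  have e: "e > 0" using \<open>H v \<bullet> u \<noteq> H u \<bullet> v\<close> by (simp add: e_def)
  obtain d1 where d1: "d1 > 0" "\<And>t. 0 < t \<Longrightarrow> t < d1 \<Longrightarrow>
    \<bar>F (z + t *\<^sub>R v + t *\<^sub>R u) - F (z + t *\<^sub>R u) - F (z + t *\<^sub>R v) + F z - t\<^sup>2 * (H v \<bullet> u)\<bar> \<le> e * t\<^sup>2"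
    using second_difference_quotient[OF assms e] by blast
  obtain d2 where d2: "d2 > 0" "\<And>t. 0 < t \<Longrightarrow> t < d2 \<Longrightarrow>
    \<bar>F (z + t *\<^sub>R u + t *\<^sub>R v) - F (z + t *\<^sub>R v) - F (z + t *\<^sub>R u) + F z - t\<^sup>2 * (H u \<bullet> v)\<bar> \<le> e * t\<^sup>2"
    using second_difference_quotient[OF assms e] by blast
  define t where "t = min d1 d2 / 2"
  have t: "0 < t" "t < d1" "t < d2" using d1(1) d2(1) by (auto simp: t_def min_def)
  have swap: "z + t *\<^sub>R u + t *\<^sub>R v = z + t *\<^sub>R v + t *\<^sub>R u" by simp
  have "\<bar>t\<^sup>2 * (H v \<bullet> u) - t\<^sup>2 * (H u \<bullet> v)\<bar> \<le> 2 * (e * t\<^sup>2)"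
    using d1(2)[OF t(1,2)] d2(2)[OF t(1,3)] unfolding swap by linarith
  also have "t\<^sup>2 * (H v \<bullet> u) - t\<^sup>2 * (H u \<bullet> v) = t\<^sup>2 * (H v \<bullet> u - H u \<bullet> v)" by (simp add: algebra_simps)
  also have "\<bar>t\<^sup>2 * (H v \<bullet> u - H u \<bullet> v)\<bar> = t\<^sup>2 * (4 * e)" by (simp add: abs_mult e_def)
  finally have "e * t\<^sup>2 \<le> 0" by simp
  then show False using e t by (simp add: mult_le_0_iff)
qed

section \<open>Second-order criteria at a critical point\<close>

lemma matrix_vector_mult_minus_left: "- A *v x = - (A *v x)" for A :: "real^'n^'m"
  by (simp add: vec_eq_iff matrix_vector_mult_def sum_negf)

locale critical_point_on_plane =
  fixes S :: "(real^'n) set" and F :: "real^'n \<Rightarrow> real" and p :: "real^'n \<Rightarrow> real^'n"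
    and H :: "real^'n^'n" and z :: "real^'n"
  assumes S: "open S" "z \<in> S" and F: "\<And>w. w \<in> S \<Longrightarrow> (F has_derivative (\<lambda>h. p w \<bullet> h)) (at w)"
    and p: "(p has_derivative (\<lambda>h. H *v h)) (at z)" and p0: "p z = 0"
begin

text \<open>Passing to \<open>- F\<close> turns maxima into minima, so the extremum criteria below
  are stated for minima only.\<close>

lemma uminus: "critical_point_on_plane S (\<lambda>w. - F w) (\<lambda>w. - p w) (- H) z"
proof
  show "((\<lambda>w. - F w) has_derivative (\<lambda>h. - p w \<bullet> h)) (at w)" if "w \<in> S" for w
    using has_derivative_minus[OF F[OF that]] by simp
  show "((\<lambda>w. - p w) has_derivative (\<lambda>h. - H *v h)) (at z)"
    using has_derivative_minus[OF p] by (simp add: matrix_vector_mult_minus_left)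
qed (use S p0 in auto)

lemma gradient_near:
  assumes "e > 0"
  obtains d where "d > 0" "ball z d \<subseteq> S"
    "\<And>h :: real^'n. norm h < d \<Longrightarrow> norm (p (z + h) - H *v h) \<le> e * norm h"
proof -
  obtain r where r: "r > 0" "ball z r \<subseteq> S" using S open_contains_ball by blast
  obtain d where d: "d > 0" "\<And>y. norm (y - z) < d \<Longrightarrow> norm (p y - p z - H *v (y - z)) \<le> e * norm (y - z)"
    using p assms unfolding has_derivative_at_alt by blast
  show thesis
  proof
    show "min r d > 0" "ball z (min r d) \<subseteq> S" using r d by auto
    fix h :: "real^'n" assume "norm h < min r d"
    then show "norm (p (z + h) - H *v h) \<le> e * norm h" using d(2)[of "z + h"] p0 by simp
  qed
qed

text \<open>On a segment leaving \<open>z\<close> the derivative of \<open>F\<close> is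
  \<open>t\<close> times the quadratic form plus an error. Choosing the coercivity constant
  \<open>l\<close> as the error constant keeps this derivative nonnegative.\<close>

lemma positive_definite_imp_local_min:
  assumes pos: "\<And>v. v \<noteq> 0 \<Longrightarrow> v \<bullet> (H *v v) > 0"
  obtains d where "d > 0" "\<And>w. dist z w < d \<Longrightarrow> F z \<le> F w"
proof -
  \<comment> \<open>Uniform coercivity is applied to a constant family over a one-point parameter
    space.\<close>
  obtain l where "l > 0" and coercive: "\<And>x v. x \<in> {0::real} \<Longrightarrow> l * (norm v)\<^sup>2 \<le> v \<bullet> (H *v v)"
    by (rule uniformly_coercive[of "{0::real}" "\<lambda>_. H"]) (simp_all add: pos)
  then have l: "l > 0" "\<And>v. l * (norm v)\<^sup>2 \<le> v \<bullet> (H *v v)" by simp_all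
  obtain d where d: "d > 0" "ball z d \<subseteq> S" "\<And>h. norm h < d \<Longrightarrow> norm (p (z + h) - H *v h) \<le> l * norm h"
    using gradient_near[OF l(1)] by blast
  show thesis
  proof
    fix w assume w: "dist z w < d"
    define u where "u = w - z"
    have u: "norm u < d" using w by (simp add: u_def dist_norm norm_minus_commute)
    have "F (z + 0 *\<^sub>R u) \<le> F (z + 1 *\<^sub>R u)"
    proof (rule DERIV_nonneg_imp_nondecreasing[of 0 1])
      fix t :: real assume t: "0 \<le> t" "t \<le> 1"
      have "norm (t *\<^sub>R u) \<le> norm u" using t mult_left_le_one_le[of "norm u" t] by simp
      then have tu: "norm (t *\<^sub>R u) < d" using u by simp
      then have "z + t *\<^sub>R u \<in> S" using d(2) by (auto simp: dist_norm)
      then have D: "DERIV (\<lambda>t. F (z + t *\<^sub>R u)) t :> p (z + t *\<^sub>R u) \<bullet> u"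
        by (intro DERIV_along_line F)
      define R where "R = p (z + t *\<^sub>R u) - H *v (t *\<^sub>R u)"
      have "\<bar>R \<bullet> u\<bar> \<le> norm R * norm u" by (rule Cauchy_Schwarz_ineq2)
      also have "\<dots> \<le> (l * norm (t *\<^sub>R u)) * norm u"
        unfolding R_def using d(3)[OF tu] by (rule mult_right_mono) simp
      also have "\<dots> = t * (l * (norm u)\<^sup>2)" using t by (simp add: power2_eq_square)
      also have "\<dots> \<le> t * (u \<bullet> (H *v u))" using t l(2) by (intro mult_left_mono)
      finally have "\<bar>R \<bullet> u\<bar> \<le> t * (u \<bullet> (H *v u))" .
      moreover have "p (z + t *\<^sub>R u) = R + t *\<^sub>R (H *v u)" by (simp add: R_def matrix_vector_mult_scaleR)
      then have "p (z + t *\<^sub>R u) \<bullet> u = R \<bullet> u + t * (u \<bullet> (H *v u))"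
        by (simp add: inner_add_left inner_commute[of u])
      ultimately have "0 \<le> p (z + t *\<^sub>R u) \<bullet> u" by linarith
      with D show "\<exists>y. DERIV (\<lambda>t. F (z + t *\<^sub>R u)) t :> y \<and> 0 \<le> y" by blast
    qed simp
    then show "F z \<le> F w" by (simp add: u_def)
  qed (use d in simp)
qed

lemma negative_direction_imp_not_local_min:
  assumes v: "v \<bullet> (H *v v) < 0" and e: "e > 0"
  obtains w where "dist z w < e" "F w < F z"
proof -
  have "v \<noteq> 0" using v by auto
  then have nv: "norm v > 0" by simp
  define k where "k = - (v \<bullet> (H *v v))"
  have k: "k > 0" using v by (simp add: k_def)
  \<comment> \<open>With this accuracy the error along the ray is at most half of the main term
    \<open>t * k\<close>.\<close>
  define l where "l = k / (2 * (norm v)\<^sup>2)"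
  have "l > 0" using k nv by (simp add: l_def)
  obtain d where d: "d > 0" "ball z d \<subseteq> S" "\<And>h. norm h < d \<Longrightarrow> norm (p (z + h) - H *v h) \<le> l * norm h"
    using gradient_near[OF \<open>l > 0\<close>] by blast
  define T where "T = min d e / (2 * norm v)"
  have T: "T > 0" "T * norm v < d" "T * norm v < e" using d e nv by (auto simp: T_def min_def)
  have der: "DERIV (\<lambda>t. F (z + t *\<^sub>R v)) t :> p (z + t *\<^sub>R v) \<bullet> v" and
    sgn: "t > 0 \<Longrightarrow> p (z + t *\<^sub>R v) \<bullet> v < 0" if t: "0 \<le> t" "t \<le> T" for t
  proof -
    have "norm (t *\<^sub>R v) \<le> T * norm v" using t by (simp add: mult_right_mono)
    then have tv: "norm (t *\<^sub>R v) < d" using T by simp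
    then have "z + t *\<^sub>R v \<in> S" using d(2) by (auto simp: dist_norm)
    then show "DERIV (\<lambda>t. F (z + t *\<^sub>R v)) t :> p (z + t *\<^sub>R v) \<bullet> v"
      by (intro DERIV_along_line F)
    assume "t > 0"
    define R where "R = p (z + t *\<^sub>R v) - H *v (t *\<^sub>R v)"
    have "\<bar>R \<bullet> v\<bar> \<le> norm R * norm v" by (rule Cauchy_Schwarz_ineq2)
    also have "\<dots> \<le> (l * norm (t *\<^sub>R v)) * norm v"
      unfolding R_def using d(3)[OF tv] by (rule mult_right_mono) simp
    also have "\<dots> = t * k / 2" using t nv by (simp add: l_def power2_eq_square)
    finally have "\<bar>R \<bullet> v\<bar> \<le> t * k / 2" .
    moreover have "p (z + t *\<^sub>R v) = R + t *\<^sub>R (H *v v)" by (simp add: R_def matrix_vector_mult_scaleR)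
    then have "p (z + t *\<^sub>R v) \<bullet> v = R \<bullet> v - t * k"
      by (simp add: inner_add_left inner_commute[of v] k_def)
    moreover have "t * k > 0" using \<open>t > 0\<close> k by simp
    ultimately show "p (z + t *\<^sub>R v) \<bullet> v < 0" by linarith
  qed
  have "F (z + T *\<^sub>R v) < F (z + 0 *\<^sub>R v)"
  proof (rule DERIV_neg_imp_decreasing_open[OF T(1)])
    show "continuous_on {0..T} (\<lambda>t. F (z + t *\<^sub>R v))"
      using der by (intro DERIV_atLeastAtMost_imp_continuous_on) blast
    show "\<exists>y. DERIV (\<lambda>t. F (z + t *\<^sub>R v)) t :> y \<and> y < 0" if "0 < t" "t < T" for t
      using der[of t] sgn[of t] that by (intro exI conjI) auto
  qed
  then have "F (z + T *\<^sub>R v) < F z" by simp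
  then show thesis using that[of "z + T *\<^sub>R v"] T by (simp add: dist_norm)
qed

text \<open>An invertible \<open>H\<close> stretches every vector by at least some factor
  \<open>B > 0\<close>, and an error of half that size cannot cancel it at another zero of
  \<open>p\<close>.\<close>

lemma nondegenerate_imp_isolated:
  assumes "det H \<noteq> 0"
  obtains d where "d > 0" "\<And>w. dist z w < d \<Longrightarrow> p w = 0 \<Longrightarrow> w = z"
proof -
  have "inj ((*v) H)"
    using assms invertible_det_nz[of H] by (metis inj_matrix_vector_mult)
  then obtain B where B: "B > 0" "\<And>v. B * norm v \<le> norm (H *v v)"
    using linear_inj_bounded_below_pos[OF matrix_vector_mul_linear] by metis
  obtain d where d: "d > 0" "ball z d \<subseteq> S" "\<And>h. norm h < d \<Longrightarrow> norm (p (z + h) - H *v h) \<le> B / 2 * norm h"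
    using gradient_near[of "B / 2"] B(1) by auto
  show thesis
  proof
    fix w assume w: "dist z w < d" "p w = 0"
    have "norm (H *v (w - z)) \<le> B / 2 * norm (w - z)"
      using d(3)[of "w - z"] w by (simp add: dist_norm norm_minus_commute)
    with B(2)[of "w - z"] have "B * norm (w - z) \<le> 0" by simp
    then show "w = z" using B(1) by (simp add: mult_le_0_iff)
  qed (use d in simp)
qed

end

text \<open>Completing the square: \<open>a\<close> times the form is
  \<open>(a * v1 + b * v2)^2\<close> plus the determinant times \<open>v2^2\<close>, so the form has
  the sign of its corner entry \<open>a\<close>.\<close>

lemma symmetric_matrix_2_definite:
  fixes H :: "real^2^2"
  assumes sym: "H $ 1 $ 2 = H $ 2 $ 1" and det: "det H > 0"
  shows "(\<forall>v. v \<noteq> 0 \<longrightarrow> v \<bullet> (H *v v) > 0) \<or> (\<forall>v. v \<noteq> 0 \<longrightarrow> v \<bullet> (- H *v v) > 0)"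
proof -
  define a b c where "a = H $ 1 $ 1" "b = H $ 1 $ 2" "c = H $ 2 $ 2"
  have D: "a * c - b * b > 0" using det sym by (simp add: det_2 a_b_c_def)
  have q: "v \<bullet> (H *v v) = a * (v$1)^2 + 2 * b * (v$1) * (v$2) + c * (v$2)^2" for v
    using sym by (simp add: inner_vec_def matrix_vector_mult_def sum_2 a_b_c_def power2_eq_square algebra_simps)
  have "a \<noteq> 0"
  proof
    assume "a = 0"
    then show False using D zero_le_square[of b] by simp
  qed
  have sq: "a * (v \<bullet> (H *v v)) > 0" if "v \<noteq> 0" for v
  proof -
    have eq: "a * (v \<bullet> (H *v v)) = (a * v$1 + b * v$2)^2 + (a * c - b * b) * (v$2)^2"
      unfolding q by (simp add: power2_eq_square algebra_simps)
    show ?thesis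
    proof (cases "v$2 = 0")
      case True
      then have "v$1 \<noteq> 0" using that by (metis (mono_tags) exhaust_2 vec_eq_iff zero_index)
      then show ?thesis using True \<open>a \<noteq> 0\<close> unfolding eq by simp
    next
      case False
      then have "(a * c - b * b) * (v$2)^2 > 0" using D by simp
      then show ?thesis unfolding eq by (simp add: add_nonneg_pos)
    qed
  qed
  have "v \<bullet> (- H *v v) = - (v \<bullet> (H *v v))" for v
    by (simp add: matrix_vector_mult_minus_left)
  then show ?thesis
    using sq \<open>a \<noteq> 0\<close> by (cases "a > 0") (auto simp: zero_less_mult_iff)
qed

text \<open>A negative determinant lifts the discriminant of the characteristic polynomial above the
  square of the trace \<open>t\<close>, so its roots \<open>(t - s) / 2\<close> and
  \<open>(t + s) / 2\<close> are real and of opposite sign.\<close>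

lemma matrix_2_indefinite:
  fixes H :: "real^2^2"
  assumes det: "det H < 0"
  shows "(\<exists>l<0. is_eigenvalue H l) \<and> (\<exists>l>0. is_eigenvalue H l)"
proof -
  define t where "t = H $ 1 $ 1 + H $ 2 $ 2"
  define s where "s = sqrt (t\<^sup>2 - 4 * det H)"
  have s2: "s\<^sup>2 = t\<^sup>2 - 4 * det H"
    unfolding s_def using det zero_le_power2[of t] by (intro real_sqrt_pow2) linarith
  have "\<bar>t\<bar> < s"
    unfolding s_def using det by (intro real_less_rsqrt) simp
  then have sg: "(t - s) / 2 < 0" "(t + s) / 2 > 0" by auto
  have eig: "is_eigenvalue H l" if l: "l\<^sup>2 - t * l + det H = 0" for l
  proof -
    have "det (H - mat l) = l\<^sup>2 - t * l + det H"
      by (simp add: det_2 t_def mat_def power2_eq_square algebra_simps)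
    then have "\<not> (\<exists>B. B ** (H - mat l) = mat 1)"
      using l invertible_det_nz[of "H - mat l"] invertible_left_inverse[of "H - mat l"] by simp
    then obtain v where v: "v \<noteq> 0" "(H - mat l) *v v = 0"
      unfolding matrix_left_invertible_ker by blast
    have "mat l *v v = l *\<^sub>R v"
      by (simp add: vec_eq_iff matrix_vector_mult_def mat_def forall_2 sum_2)
    then have "H *v v = l *\<^sub>R v" using v(2) by (simp add: matrix_vector_mult_diff_rdistrib)
    with v show ?thesis unfolding is_eigenvalue_def by blast
  qed
  have "((t - s) / 2)\<^sup>2 - t * ((t - s) / 2) + det H = (s\<^sup>2 - t\<^sup>2 + 4 * det H) / 4"
    "((t + s) / 2)\<^sup>2 - t * ((t + s) / 2) + det H = (s\<^sup>2 - t\<^sup>2 + 4 * det H) / 4"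
    by (simp_all add: power2_eq_square field_simps)
  then have "is_eigenvalue H ((t - s) / 2)" "is_eigenvalue H ((t + s) / 2)"
    using s2 by (simp_all add: eig)
  then show ?thesis using sg by blast
qed

section \<open>Topological dynamics of gradient-like flows\<close>

lemma relatively_openE:
  assumes "openin (top_of_set M) U"
  obtains T where "open T" "U = M \<inter> T"
  using assms unfolding openin_open by blast

text \<open>The ambient space is only Hausdorff, so separation from a closed set is available only
  for compact ones, by a finite subcover.\<close>

lemma compact_point_separation:
  fixes K :: "'a::t2_space set"
  assumes "compact K" "x \<notin> K"
  obtains P Q where "open P" "open Q" "x \<in> P" "K \<subseteq> Q" "P \<inter> Q = {}"
proof -
  have "\<forall>y\<in>K. \<exists>P Q. open P \<and> open Q \<and> x \<in> P \<and> y \<in> Q \<and> P \<inter> Q = {}"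
    by (metis assms(2) hausdorff)
  then obtain P Q where PQ: "\<And>y. y \<in> K \<Longrightarrow>
      open (P y) \<and> open (Q y) \<and> x \<in> P y \<and> y \<in> Q y \<and> P y \<inter> Q y = {}"
    by metis
  then have "\<And>y. y \<in> K \<Longrightarrow> open (Q y)" "K \<subseteq> (\<Union>y\<in>K. Q y)" by auto
  then obtain C where C: "C \<subseteq> K" "finite C" "K \<subseteq> (\<Union>y\<in>C. Q y)"
    using compactE_image[OF assms(1)] by metis
  show thesis
  proof
    show "open (\<Inter>y\<in>C. P y)" "open (\<Union>y\<in>C. Q y)" "x \<in> (\<Inter>y\<in>C. P y)"
      using PQ C by (auto intro!: open_INT)
    show "K \<subseteq> (\<Union>y\<in>C. Q y)" by fact
    show "(\<Inter>y\<in>C. P y) \<inter> (\<Union>y\<in>C. Q y) = {}" using PQ C(1) by blast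
  qed
qed

lemma connected_openinD:
  assumes "connected S" "openin (top_of_set S) U" "openin (top_of_set S) V" "S = U \<union> V" "U \<inter> V = {}"
  shows "U = {} \<or> V = {}"
proof (rule ccontr)
  assume "\<not> (U = {} \<or> V = {})"
  then have "\<exists>E1 E2. openin (top_of_set S) E1 \<and> openin (top_of_set S) E2 \<and> S \<subseteq> E1 \<union> E2 \<and>
      E1 \<inter> E2 = {} \<and> E1 \<noteq> {} \<and> E2 \<noteq> {}"
    using assms by (intro exI[of _ U] exI[of _ V]) auto
  with assms(1) show False unfolding connected_openin by (rule notE)
qed

text \<open>They stand in for critical points where only the flow is known and there are no charts;
  \<open>rest_points_eq\<close> identifies the two.\<close>

definition rest_points :: "'a set \<Rightarrow> (real \<Rightarrow> 'a \<Rightarrow> 'a) \<Rightarrow> 'a set" where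
  "rest_points M \<phi> = {x \<in> M. \<forall>t. \<phi> t x = x}"

section \<open>Time reversal and local extrema\<close>

lemma reversed_stable_set: "stable_set M (\<lambda>t. \<phi> (- t)) x = unstable_set M \<phi> x"
  by (simp add: stable_set_def unstable_set_def filterlim_at_bot_mirror)

lemma reversed_unstable_set: "unstable_set M (\<lambda>t. \<phi> (- t)) x = stable_set M \<phi> x"
  by (simp add: stable_set_def unstable_set_def filterlim_at_bot_mirror)

lemma reversed_rest_points: "rest_points M (\<lambda>t. \<phi> (- t)) = rest_points M \<phi>"
  unfolding rest_points_def by (metis minus_minus)

lemma local_minima_uminus: "local_minima M (\<lambda>x. - f x) = local_maxima M f"
  for f :: "'a::topological_space \<Rightarrow> real"
  by (simp add: local_minima_def local_maxima_def)

lemma local_maxima_uminus: "local_maxima M (\<lambda>x. - f x) = local_minima M f"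
  for f :: "'a::topological_space \<Rightarrow> real"
  by (simp add: local_minima_def local_maxima_def)

text \<open>\<open>U\<close> is also a neighbourhood of its points at the level of \<open>p\<close>,
  so these are minima too. Once minima are known to be isolated rest points, this makes
  \<open>p\<close> a strict minimum.\<close>

lemma local_minima_nbhd:
  assumes "p \<in> local_minima M f"
  obtains U where "openin (top_of_set M) U" "p \<in> U" "\<And>y. y \<in> U \<Longrightarrow> f p \<le> f y"
    "U \<subseteq> local_minima M f \<union> {y. f p < f y}"
proof -
  obtain U where U: "openin (top_of_set M) U" "p \<in> U" "\<And>y. y \<in> U \<Longrightarrow> f p \<le> f y"
    using assms unfolding local_minima_def by blast
  moreover have "y \<in> local_minima M f" if "y \<in> U" "\<not> f p < f y" for y
    unfolding local_minima_def using U that openin_imp_subset by fastforce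
  ultimately show thesis using that by blast
qed

text \<open>An interface free of charts and preserved by reversing time and negating
  \<open>f\<close>. The last axiom describes small discs with their centre removed; it is the trace
  left by the dimension of the surface.\<close>

locale gradient_like_flow =
  fixes M :: "'a::t2_space set" and f :: "'a \<Rightarrow> real" and \<phi> :: "real \<Rightarrow> 'a \<Rightarrow> 'a"
  assumes compact_M: "compact M" and connected_M: "connected M"
    and flow_in: "x \<in> M \<Longrightarrow> \<phi> t x \<in> M"
    and flow_0: "x \<in> M \<Longrightarrow> \<phi> 0 x = x"
    and flow_add: "x \<in> M \<Longrightarrow> \<phi> (s + t) x = \<phi> s (\<phi> t x)"
    and orbit_cont: "x \<in> M \<Longrightarrow> continuous_on UNIV (\<lambda>t. \<phi> t x)"
    and flow_cont: "continuous_on M (\<phi> t)"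
    and f_cont: "continuous_on M f"
    and f_decr: "x \<in> M \<Longrightarrow> x \<notin> rest_points M \<phi> \<Longrightarrow> t > 0 \<Longrightarrow> f (\<phi> t x) < f x"
    and finite_rest: "finite (rest_points M \<phi>)"
    and punctured: "x \<in> M \<Longrightarrow> openin (top_of_set M) U \<Longrightarrow> x \<in> U \<Longrightarrow>
      \<exists>W. openin (top_of_set M) W \<and> x \<in> W \<and> W \<subseteq> U \<and> connected (W - {x}) \<and> W - {x} \<noteq> {}"
begin

abbreviation "rest \<equiv> rest_points M \<phi>"

section \<open>Orbits, rest points and limits\<close>

lemma restD: "x \<in> rest \<Longrightarrow> x \<in> M" "x \<in> rest \<Longrightarrow> \<phi> t x = x"
  by (auto simp: rest_points_def)

lemma flow_inverse: "x \<in> M \<Longrightarrow> \<phi> (- t) (\<phi> t x) = x" "x \<in> M \<Longrightarrow> \<phi> t (\<phi> (- t) x) = x"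
  using flow_add[of x "-t" t] flow_add[of x t "-t"] flow_0 by auto

lemma rest_if_reaches_rest: "x \<in> M \<Longrightarrow> \<phi> t x \<in> rest \<Longrightarrow> x \<in> rest"
  using flow_inverse(1)[of x t] restD(2)[of "\<phi> t x" "-t"] by simp

lemma reversed: "gradient_like_flow M (\<lambda>x. - f x) (\<lambda>t. \<phi> (- t))"
proof
  show "compact M" "connected M" by (fact compact_M connected_M)+
  show "\<phi> (- t) x \<in> M" if "x \<in> M" for x t using that by (rule flow_in)
  show "\<phi> (- 0) x = x" if "x \<in> M" for x using that flow_0 by simp
  show "\<phi> (- (s + t)) x = \<phi> (- s) (\<phi> (- t) x)" if "x \<in> M" for s t x
    using that flow_add[of x "-s" "-t"] by simp
  show "continuous_on UNIV (\<lambda>t. \<phi> (- t) x)" if "x \<in> M" for x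
    using continuous_on_compose2[OF orbit_cont[OF that], of UNIV uminus]
    by (simp add: continuous_on_minus)
  show "continuous_on M (\<phi> (- t))" for t by (rule flow_cont)
  show "continuous_on M (\<lambda>x. - f x)" by (intro continuous_intros f_cont)
  show "- f (\<phi> (- t) x) < - f x"
    if "x \<in> M" "x \<notin> rest_points M (\<lambda>t. \<phi> (- t))" "0 < t" for x t
    \<comment> \<open>The strict decrease from \<open>\<phi> (- t) x\<close> to \<open>x\<close> is
      read backwards.\<close>
    using f_decr[of "\<phi> (-t) x" t] that rest_if_reaches_rest[of x "-t"] flow_in[of x "-t"]
      flow_inverse(2)[of x t] by (auto simp: reversed_rest_points)
  show "finite (rest_points M (\<lambda>t. \<phi> (- t)))" by (simp add: reversed_rest_points finite_rest)
qed (fact punctured)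

lemma f_antimono: "x \<in> M \<Longrightarrow> s \<le> t \<Longrightarrow> f (\<phi> t x) \<le> f (\<phi> s x)"
  using f_decr[of "\<phi> s x" "t - s"] flow_add[of x "t - s" s] flow_in[of x s] restD(2)[of "\<phi> s x"]
  by (cases "s = t"; cases "\<phi> s x \<in> rest") force+

lemma stable_shift:
  assumes "x \<in> M"
  shows "\<phi> s x \<in> stable_set M \<phi> p \<longleftrightarrow> x \<in> stable_set M \<phi> p"
proof -
  have eq: "(\<lambda>t. \<phi> t (\<phi> s x)) = (\<lambda>t. \<phi> (t + s) x)" using flow_add assms by auto
  have "((\<lambda>t. \<phi> (t + s) x) \<longlongrightarrow> p) at_top \<longleftrightarrow> ((\<lambda>t. \<phi> t x) \<longlongrightarrow> p) at_top"
  proof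
    assume L: "((\<lambda>t. \<phi> (t + s) x) \<longlongrightarrow> p) at_top"
    have "filterlim (\<lambda>t::real. t + (- s)) at_top at_top"
      by (rule filterlim_tendsto_add_at_top[of "\<lambda>t. - s", THEN filterlim_cong[THEN iffD1, rotated -1]])
         (auto intro!: filterlim_ident)
    from filterlim_compose[OF L this] show "((\<lambda>t. \<phi> t x) \<longlongrightarrow> p) at_top" by simp
  next
    assume L: "((\<lambda>t. \<phi> t x) \<longlongrightarrow> p) at_top"
    have "filterlim (\<lambda>t::real. t + s) at_top at_top"
      by (rule filterlim_tendsto_add_at_top[of "\<lambda>t. s", THEN filterlim_cong[THEN iffD1, rotated -1]])
         (auto intro!: filterlim_ident)
    from filterlim_compose[OF L this] show "((\<lambda>t. \<phi> (t + s) x) \<longlongrightarrow> p) at_top" by simp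
  qed
  then show ?thesis unfolding stable_set_def mem_Collect_eq eq using assms flow_in by blast
qed

lemma stable_subset: "stable_set M \<phi> p \<subseteq> M"
  by (auto simp: stable_set_def)

lemma stable_unique: "x \<in> stable_set M \<phi> p \<Longrightarrow> x \<in> stable_set M \<phi> q \<Longrightarrow> p = q"
  unfolding stable_set_def using tendsto_unique trivial_limit_at_top_linorder by blast

lemma rest_in_stable: "x \<in> rest \<Longrightarrow> x \<in> stable_set M \<phi> x"
  by (auto simp: stable_set_def rest_points_def)

lemma rest_isolated:
  assumes "x \<in> M"
  obtains U where "openin (top_of_set M) U" "x \<in> U" "U \<inter> rest \<subseteq> {x}"
proof
  show "openin (top_of_set M) (M \<inter> - (rest - {x}))"
    using finite_rest by (intro openin_open_Int open_Compl finite_imp_closed) simp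
qed (use assms in auto)

text \<open>Off the rest points \<open>f\<close> drops at every positive time, while for small times
  the orbit is still in the neighbourhood on which \<open>x\<close> is minimal.\<close>

lemma local_minima_rest: "local_minima M f \<subseteq> rest"
proof
  fix x assume x: "x \<in> local_minima M f"
  then obtain T where T: "open T" "x \<in> T" "x \<in> M" "\<And>y. y \<in> M \<inter> T \<Longrightarrow> f x \<le> f y"
    unfolding local_minima_def openin_open by blast
  show "x \<in> rest"
  proof (rule ccontr)
    assume n: "x \<notin> rest"
    have "((\<lambda>t. \<phi> t x) \<longlongrightarrow> \<phi> 0 x) (at 0)"
      using orbit_cont[OF \<open>x \<in> M\<close>] by (simp add: continuous_on_def)
    then have "\<forall>\<^sub>F t in at 0. \<phi> t x \<in> T" using T flow_0 by (metis topological_tendstoD)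
    then have "\<forall>\<^sub>F t in at_right 0. \<phi> t x \<in> T" using at_within_le_at filter_leD by blast
    then have "\<forall>\<^sub>F t in at_right (0::real). False"
      using eventually_at_right_less[of 0]
    proof eventually_elim
      case (elim t)
      then show False using f_decr[OF \<open>x \<in> M\<close> n, of t] T flow_in[of x t] by force
    qed
    then show False by simp
  qed
qed

text \<open>Near such a point \<open>f\<close> would be constant, so all nearby points would be
  minima and hence rest points; but rest points are isolated and punctured neighbourhoods are
  nonempty.\<close>

lemma minima_not_maxima: "local_minima M f \<inter> local_maxima M f = {}"
proof (rule ccontr)
  assume "local_minima M f \<inter> local_maxima M f \<noteq> {}"
  then obtain p where p: "p \<in> local_minima M f" "p \<in> local_maxima M f" by blast
  then have pM: "p \<in> M" using local_minima_rest restD by blast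
  obtain U where U: "openin (top_of_set M) U" "p \<in> U" "U \<subseteq> local_minima M f \<union> {y. f p < f y}"
    using local_minima_nbhd[OF p(1)] by metis
  obtain V where V: "openin (top_of_set M) V" "p \<in> V" "\<And>y. y \<in> V \<Longrightarrow> f y \<le> f p"
    using p(2) unfolding local_maxima_def by blast
  obtain O' where O': "openin (top_of_set M) O'" "p \<in> O'" "O' \<inter> rest \<subseteq> {p}"
    using rest_isolated[OF pM] by metis
  have op: "openin (top_of_set M) (U \<inter> V \<inter> O')" using U V O' by (intro openin_Int)
  have "p \<in> U \<inter> V \<inter> O'" using U V O' by simp
  then obtain W where W: "W \<subseteq> U \<inter> V \<inter> O'" "W - {p} \<noteq> {}"
    using punctured[OF pM op] by auto
  then obtain y where y: "y \<in> U" "y \<in> V" "y \<in> O'" "y \<noteq> p" by blast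
  with U V have "y \<in> local_minima M f" by fastforce
  with y O' local_minima_rest show False by blast
qed

text \<open>An accumulation point \<open>y\<close> of a forward orbit has \<open>f y = c\<close>, the infimum of \<open>f\<close> along
  the orbit; if \<open>y\<close> were not at rest, then \<open>f (\<phi> 1 y) < c\<close>, and the orbit would go below \<open>c\<close>.\<close>

lemma avoids_nonrest:
  assumes "x \<in> M" "y \<in> M" "y \<notin> rest"
  obtains U where "openin (top_of_set M) U" "y \<in> U" "\<forall>\<^sub>F t in at_top. \<phi> t x \<notin> U"
proof -
  define c where "c = (INF t. f (\<phi> t x))"
  have "bdd_below (f ` M)"
    by (intro bounded_imp_bdd_below compact_imp_bounded compact_continuous_image f_cont compact_M)
  then have bdd: "bdd_below (range (\<lambda>t. f (\<phi> t x)))"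
    by (rule bdd_below_mono) (use flow_in[OF \<open>x \<in> M\<close>] in auto)
  then have c: "c \<le> f (\<phi> t x)" for t
    unfolding c_def using cINF_lower[OF bdd, of t] by simp
  \<comment> \<open>Levels below the infimum are never reached, and levels above it are eventually
    left for good because \<open>f\<close> does not increase along the orbit.\<close>
  consider "f y < c" | "f y > c" | "f y = c" by linarith
  then show thesis
  proof cases
    case 1
    show thesis
    proof
      show "openin (top_of_set M) (M \<inter> f -` {..<c})"
        by (intro continuous_openin_preimage_gen f_cont) simp
      show "\<forall>\<^sub>F t in at_top. \<phi> t x \<notin> M \<inter> f -` {..<c}"
        using c by (auto simp: not_less)
    qed (use 1 assms in auto)
  next
    case 2
    then obtain T where T: "f (\<phi> T x) < f y"
      unfolding c_def using cINF_less_iff[OF _ bdd, of "f y"] by auto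
    show thesis
    proof
      show "openin (top_of_set M) (M \<inter> f -` {f (\<phi> T x)<..})"
        by (intro continuous_openin_preimage_gen f_cont) simp
      show "\<forall>\<^sub>F t in at_top. \<phi> t x \<notin> M \<inter> f -` {f (\<phi> T x)<..}"
        using eventually_ge_at_top[of T]
      proof eventually_elim
        case (elim t)
        then show ?case using f_antimono[OF \<open>x \<in> M\<close>, of T t] by auto
      qed
    qed (use T assms in auto)
  next
    case 3
    have "continuous_on M (\<lambda>w. f (\<phi> 1 w))"
      by (rule continuous_on_compose2[OF f_cont flow_cont]) (use flow_in in auto)
    then have op: "openin (top_of_set M) (M \<inter> (\<lambda>w. f (\<phi> 1 w)) -` {..<c})"
      by (intro continuous_openin_preimage_gen) simp_all
    show thesis
    proof
      show "y \<in> M \<inter> (\<lambda>w. f (\<phi> 1 w)) -` {..<c}"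
        using f_decr[OF assms(2,3), of 1] 3 assms by auto
      have "f (\<phi> 1 (\<phi> t x)) \<ge> c" for t using c[of "1+t"] flow_add[OF \<open>x \<in> M\<close>, of 1 t] by simp
      then show "\<forall>\<^sub>F t in at_top. \<phi> t x \<notin> M \<inter> (\<lambda>w. f (\<phi> 1 w)) -` {..<c}"
        by (auto simp: not_less)
    qed (fact op)
  qed
qed

text \<open>By compactness some rest point \<open>p\<close> is a limit point of the orbit. The tail
  of the orbit is connected and ends up in two disjoint open sets, one around \<open>p\<close> and
  one around the other rest points, so it stays in the first. Having only finitely many rest points
  thus upgrades accumulation to convergence.\<close>

lemma orbit_converges:
  assumes "x \<in> M"
  obtains p where "p \<in> rest" "x \<in> stable_set M \<phi> p"
proof -
  \<comment> \<open>The negation says that \<open>y\<close> is an omega-limit point of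
    \<open>x\<close>.\<close>
  define avoided where "avoided y \<longleftrightarrow> (\<exists>U. openin (top_of_set M) U \<and> y \<in> U \<and>
      (\<forall>\<^sub>F t in at_top. \<phi> t x \<notin> U))" for y
  have "\<exists>p\<in>rest. \<not> avoided p"
  proof (rule ccontr)
    assume "\<not> (\<exists>p\<in>rest. \<not> avoided p)"
    then have "\<forall>y\<in>M. avoided y"
      using avoids_nonrest[OF assms] unfolding avoided_def by metis
    then have "\<forall>y\<in>M. \<exists>T. open T \<and> y \<in> T \<and> (\<forall>\<^sub>F t in at_top. \<phi> t x \<notin> M \<inter> T)"
      unfolding avoided_def openin_open by (metis IntD2)
    then obtain T where T: "\<And>y. y \<in> M \<Longrightarrow>
        open (T y) \<and> y \<in> T y \<and> (\<forall>\<^sub>F t in at_top. \<phi> t x \<notin> M \<inter> T y)"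
      by metis
    then have "\<And>y. y \<in> M \<Longrightarrow> open (T y)" "M \<subseteq> (\<Union>y\<in>M. T y)" by auto
    then obtain C where C: "C \<subseteq> M" "finite C" "M \<subseteq> (\<Union>y\<in>C. T y)"
      using compactE_image[OF compact_M] by metis
    have "\<forall>\<^sub>F t in at_top. \<forall>y\<in>C. \<phi> t x \<notin> M \<inter> T y"
      using C T by (intro eventually_ball_finite) blast+
    then have "\<forall>\<^sub>F t::real in at_top. False"
      by eventually_elim (use flow_in[OF assms] C(3) in blast)
    then show False by simp
  qed
  then obtain p where p: "p \<in> rest" "\<not> avoided p" by blast
  have "((\<lambda>t. \<phi> t x) \<longlongrightarrow> p) at_top"
  proof (rule topological_tendstoI)
    fix S assume S: "open S" "p \<in> S"
    obtain P Q where PQ: "open P" "open Q" "p \<in> P" "rest - {p} \<subseteq> Q" "P \<inter> Q = {}"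
      using compact_point_separation[of "rest - {p}" p] finite_rest
      by (metis Diff_iff finite_Diff finite_imp_compact insertI1)
    \<comment> \<open>Outside \<open>R\<close> there are no rest points, so this compact remainder
      of \<open>M\<close> is covered by finitely many neighbourhoods that the orbit eventually
      avoids.\<close>
    define R where "R = P \<inter> S \<union> Q"
    have "compact (M - R)"
      using PQ S by (intro compact_diff compact_M) (auto simp: R_def)
    moreover have "\<forall>y\<in>M - R. \<exists>T. open T \<and> y \<in> T \<and> (\<forall>\<^sub>F t in at_top. \<phi> t x \<notin> M \<inter> T)"
    proof
      fix y assume y: "y \<in> M - R"
      then have "y \<notin> rest" using PQ S by (auto simp: R_def)
      then obtain U where "openin (top_of_set M) U" "y \<in> U" "\<forall>\<^sub>F t in at_top. \<phi> t x \<notin> U"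
        using avoids_nonrest[OF assms] y by blast
      then show "\<exists>T. open T \<and> y \<in> T \<and> (\<forall>\<^sub>F t in at_top. \<phi> t x \<notin> M \<inter> T)"
        by (auto simp: openin_open)
    qed
    then obtain T where T: "\<And>y. y \<in> M - R \<Longrightarrow>
        open (T y) \<and> y \<in> T y \<and> (\<forall>\<^sub>F t in at_top. \<phi> t x \<notin> M \<inter> T y)"
      by metis
    then have "\<And>y. y \<in> M - R \<Longrightarrow> open (T y)" "M - R \<subseteq> (\<Union>y\<in>M - R. T y)" by auto
    ultimately obtain C where C: "C \<subseteq> M - R" "finite C" "M - R \<subseteq> (\<Union>y\<in>C. T y)"
      using compactE_image by metis
    have "\<forall>\<^sub>F t in at_top. \<forall>y\<in>C. \<phi> t x \<notin> M \<inter> T y"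
      using C T by (intro eventually_ball_finite) blast+
    then have "\<forall>\<^sub>F t in at_top. \<phi> t x \<in> R"
      by eventually_elim (use flow_in[OF assms] C(3) in blast)
    then obtain t0 where t0: "\<And>t. t \<ge> t0 \<Longrightarrow> \<phi> t x \<in> R"
      unfolding eventually_at_top_linorder by blast
    have "connected ((\<lambda>t. \<phi> t x) ` {t0..})"
      by (intro connected_continuous_image continuous_on_subset[OF orbit_cont[OF assms]])
        (auto simp: connected_Ici)
    then have "P \<inter> S \<inter> (\<lambda>t. \<phi> t x) ` {t0..} = {} \<or> Q \<inter> (\<lambda>t. \<phi> t x) ` {t0..} = {}"
      using PQ S t0 by (intro connectedD) (auto simp: R_def)
    then show "\<forall>\<^sub>F t in at_top. \<phi> t x \<in> S"
    proof
      assume "P \<inter> S \<inter> (\<lambda>t. \<phi> t x) ` {t0..} = {}"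
      then have "\<forall>\<^sub>F t in at_top. \<phi> t x \<notin> M \<inter> (P \<inter> S)"
        by (intro eventually_at_top_linorderI[of t0]) auto
      moreover have "openin (top_of_set M) (M \<inter> (P \<inter> S))"
        using PQ S by (intro openin_open_Int open_Int)
      moreover have "p \<in> M \<inter> (P \<inter> S)" using p(1) restD(1) PQ S by simp
      ultimately have "avoided p" unfolding avoided_def by (intro exI conjI)
      with p show ?thesis by simp
    next
      assume "Q \<inter> (\<lambda>t. \<phi> t x) ` {t0..} = {}"
      then show ?thesis
        using t0 by (intro eventually_at_top_linorderI[of t0]) (auto simp: R_def)
    qed
  qed
  with p show thesis using that assms by (simp add: stable_set_def)
qed

text \<open>Lyapunov's argument: \<open>V\<close> is the part of a small neighbourhood
  \<open>P\<close> on which \<open>f\<close> lies below all its values on the frontier of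
  \<open>P\<close>, and these exceed \<open>f p\<close>. Since \<open>f\<close> does not increase
  along orbits, no orbit from \<open>V\<close> can cross the frontier, and \<open>p\<close> is the
  only rest point available as its limit.\<close>

lemma trapping_nbhd:
  assumes p: "p \<in> local_minima M f" and U: "openin (top_of_set M) U" "p \<in> U"
  obtains V where "openin (top_of_set M) V" "p \<in> V" "closure V \<subseteq> U"
    "V \<subseteq> stable_set M \<phi> p" "\<And>x t. x \<in> V \<Longrightarrow> t \<ge> 0 \<Longrightarrow> \<phi> t x \<in> V"
proof -
  have pM: "p \<in> M" using p local_minima_rest restD by blast
  obtain U1 where U1: "openin (top_of_set M) U1" "p \<in> U1" "U1 \<subseteq> local_minima M f \<union> {y. f p < f y}"
    using local_minima_nbhd[OF p] by metis
  obtain U2 where U2: "openin (top_of_set M) U2" "p \<in> U2" "U2 \<inter> rest \<subseteq> {p}"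
    using rest_isolated[OF pM] by metis
  define O' where "O' = U \<inter> U1 \<inter> U2"
  have O': "openin (top_of_set M) O'" "p \<in> O'" using U U1 U2 by (auto simp: O'_def)
  have "compact (M - O')"
    using O'(1) compact_M unfolding openin_open by (metis Diff_Int_distrib2 Diff_Int Diff_cancel Un_empty_left compact_diff)
  \<comment> \<open>Separating \<open>p\<close> from the complement of \<open>O'\<close> forces the
    closure of \<open>P\<close>, within \<open>M\<close>, into \<open>O'\<close>.\<close>
  then obtain P Q where PQ: "open P" "open Q" "p \<in> P" "M - O' \<subseteq> Q" "P \<inter> Q = {}"
    using compact_point_separation[of "M - O'" p] O'(2) by blast
  have clP: "closure P \<inter> Q = {}" using PQ by (simp add: open_Int_closure_eq_empty inf_commute)
  have closedM: "closed M" using compact_M by (rule compact_imp_closed)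
  define B where "B = M \<inter> (closure P - P)"
  have B: "compact B" unfolding B_def using PQ compact_M by (intro compact_Int_closed) auto
  have fB: "f p < f b" if "b \<in> B" for b
  proof -
    have "b \<in> O'" "b \<noteq> p" using that clP PQ by (auto simp: B_def)
    then show ?thesis using U1 U2 local_minima_rest unfolding O'_def by blast
  qed
  define V where "V = {w \<in> M \<inter> P. \<forall>b\<in>B. f w < f b}"
  have oV: "openin (top_of_set M) V"
  proof (cases "B = {}")
    case True
    then have "V = M \<inter> P" by (auto simp: V_def)
    then show ?thesis using PQ by (simp add: openin_open_Int)
  next
    case False
    then obtain b0 where b0: "b0 \<in> B" "\<And>b. b \<in> B \<Longrightarrow> f b0 \<le> f b"
      using continuous_attains_inf[OF B False continuous_on_subset[OF f_cont]]
      by (auto simp: B_def)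
    then have "V = (M \<inter> P) \<inter> (M \<inter> f -` {..<f b0})"
      by (force simp: V_def)
    moreover have "openin (top_of_set M) (M \<inter> f -` {..<f b0})"
      by (intro continuous_openin_preimage_gen f_cont) simp
    ultimately show ?thesis using PQ by (simp add: openin_Int openin_open_Int)
  qed
  have pV: "p \<in> V" using pM PQ fB by (auto simp: V_def)
  have inv: "\<phi> t w \<in> V" if w: "w \<in> V" "t \<ge> 0" for w t
  proof -
    have wM: "w \<in> M" "w \<in> P" using w by (auto simp: V_def)
    define J where "J = (\<lambda>s. \<phi> s w) ` {0..}"
    have lt: "f (\<phi> s w) < f b" if "s \<ge> 0" "b \<in> B" for s b
      using f_antimono[OF wM(1), of 0 s] flow_0[OF wM(1)] w that by (force simp: V_def)
    have "\<phi> s w \<notin> B" if "s \<ge> 0" for s using lt[OF that, of "\<phi> s w"] by blast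
    then have "J \<inter> B = {}" "J \<subseteq> M" using flow_in[OF wM(1)] by (auto simp: J_def)
    moreover have "connected J" unfolding J_def
      by (intro connected_continuous_image continuous_on_subset[OF orbit_cont[OF wM(1)]])
        (auto simp: connected_Ici)
    moreover have "w \<in> J" unfolding J_def using flow_0[OF wM(1)]
      by (intro image_eqI[of _ _ 0]) auto
    ultimately have "P \<inter> J = {} \<or> - closure P \<inter> J = {}"
      using PQ wM closure_subset[of P] by (intro connectedD) (auto simp: B_def)
    then have "- closure P \<inter> J = {}" using \<open>w \<in> J\<close> wM by blast
    then have "J \<subseteq> P" using \<open>J \<inter> B = {}\<close> \<open>J \<subseteq> M\<close> by (auto simp: B_def)
    then show ?thesis using w lt flow_in[OF wM(1)] by (auto simp: V_def J_def)
  qed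
  have clV: "closure V \<subseteq> M \<inter> closure P"
    using closedM by (intro closure_minimal) (auto simp: V_def closure_subset[THEN subsetD])
  have clVU: "closure V \<subseteq> O'" using clV clP PQ by blast
  show thesis
  proof
    show "closure V \<subseteq> U" using clVU by (auto simp: O'_def)
    show "V \<subseteq> stable_set M \<phi> p"
    proof
      fix w assume w: "w \<in> V"
      then have "w \<in> M" by (simp add: V_def)
      then obtain p' where p': "p' \<in> rest" "w \<in> stable_set M \<phi> p'" by (rule orbit_converges)
      have "((\<lambda>t. \<phi> t w) \<longlongrightarrow> p') at_top" using p'(2) by (simp add: stable_set_def)
      moreover have "\<forall>\<^sub>F t in at_top. \<phi> t w \<in> closure V"
        using eventually_ge_at_top[of 0] by eventually_elim (use inv[OF w] closure_subset in blast)
      ultimately have "p' \<in> closure V" by (intro Lim_in_closed_set) auto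
      then have "p' = p" using clVU p'(1) U2 by (auto simp: O'_def)
      with p' show "w \<in> stable_set M \<phi> p" by simp
    qed
  qed (fact oV pV | rule inv)+
qed

section \<open>Stable sets of extrema\<close>

lemma flow_preimage_open:
  "openin (top_of_set M) V \<Longrightarrow> openin (top_of_set M) (M \<inter> \<phi> t -` V)"
  using flow_in by (intro continuous_openin_preimage[OF flow_cont]) auto

lemma stable_set_hits_nbhd:
  assumes "x \<in> stable_set M \<phi> p" "openin (top_of_set M) V" "p \<in> V"
  shows "\<forall>\<^sub>F t in at_top. \<phi> t x \<in> V"
proof -
  obtain T where T: "open T" "V = M \<inter> T" using assms(2) by (rule relatively_openE)
  then have "\<forall>\<^sub>F t in at_top. \<phi> t x \<in> T"
    using assms topological_tendstoD unfolding stable_set_def by blast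
  then show ?thesis by eventually_elim (use T assms(1) flow_in in \<open>auto simp: stable_set_def\<close>)
qed

text \<open>The stable set is the union of the preimages of a trapping neighbourhood under the
  continuous time maps.\<close>

lemma stable_set_minimum_open:
  assumes p: "p \<in> local_minima M f"
  shows "openin (top_of_set M) (stable_set M \<phi> p)"
proof -
  have "p \<in> M" using p local_minima_rest restD by blast
  then obtain V where V: "openin (top_of_set M) V" "p \<in> V" "V \<subseteq> stable_set M \<phi> p"
    using trapping_nbhd[OF p openin_topspace] by (metis topspace_euclidean_subtopology)
  have "stable_set M \<phi> p = (\<Union>t. M \<inter> \<phi> t -` V)"
  proof (intro equalityI subsetI)
    fix x assume x: "x \<in> stable_set M \<phi> p"
    then have "\<forall>\<^sub>F t in at_top. \<phi> t x \<in> V" using stable_set_hits_nbhd V by blast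
    then obtain t where "\<phi> t x \<in> V" unfolding eventually_at_top_linorder by blast
    then show "x \<in> (\<Union>t. M \<inter> \<phi> t -` V)" using x stable_subset by blast
  next
    fix x assume "x \<in> (\<Union>t. M \<inter> \<phi> t -` V)"
    then show "x \<in> stable_set M \<phi> p" using V(3) stable_shift by blast
  qed
  moreover have "openin (top_of_set M) (\<Union>t. M \<inter> \<phi> t -` V)"
    using flow_preimage_open[OF V(1)] by (intro openin_Union) blast
  ultimately show ?thesis by simp
qed

text \<open>On a nonconstant orbit \<open>f\<close> decreases strictly towards its limit
  \<open>f p\<close> and therefore stays above it, which is impossible near a maximum.\<close>

lemma stable_set_maximum:
  assumes p: "p \<in> local_maxima M f" and x: "x \<in> stable_set M \<phi> p"
  shows "x = p"
proof -
  have xM: "x \<in> M" and lim: "((\<lambda>t. \<phi> t x) \<longlongrightarrow> p) at_top" using x by (auto simp: stable_set_def)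
  obtain U where U: "openin (top_of_set M) U" "p \<in> U" "\<And>y. y \<in> U \<Longrightarrow> f y \<le> f p"
    using p unfolding local_maxima_def by blast
  have pM: "p \<in> M" using U openin_imp_subset by blast
  have "x \<in> rest"
  proof (rule ccontr)
    assume n: "x \<notin> rest"
    have flim: "((\<lambda>t. f (\<phi> t x)) \<longlongrightarrow> f p) at_top"
      using continuous_on_tendsto_compose[OF f_cont lim pM] flow_in[OF xM] by simp
    have "\<forall>\<^sub>F t in at_top. \<phi> t x \<in> U" using stable_set_hits_nbhd x U by blast
    then obtain t where t: "\<phi> t x \<in> U" unfolding eventually_at_top_linorder by blast
    have "\<phi> t x \<notin> rest" using n rest_if_reaches_rest[OF xM] by blast
    then have "f (\<phi> (1 + t) x) < f (\<phi> t x)"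
      using f_decr[of "\<phi> t x" 1] flow_add[OF xM, of 1 t] flow_in[OF xM] by simp
    moreover have "f p \<le> f (\<phi> (1 + t) x)"
    proof (rule tendsto_upperbound[OF flim])
      show "\<forall>\<^sub>F s in at_top. f (\<phi> s x) \<le> f (\<phi> (1 + t) x)"
        using eventually_ge_at_top[of "1+t"] by eventually_elim (rule f_antimono[OF xM])
    qed simp
    ultimately show False using U(3)[OF t] by simp
  qed
  then show ?thesis using x rest_in_stable stable_unique by blast
qed

text \<open>A separation of \<open>M - {p}\<close> would extend to \<open>M\<close>: a connected
  punctured neighbourhood of \<open>p\<close> lies on one side, and \<open>p\<close> can be added to
  that side without spoiling openness.\<close>

lemma connected_punctured_M:
  assumes "p \<in> M"
  shows "connected (M - {p})"
proof (rule ccontr)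
  assume "\<not> connected (M - {p})"
  then obtain E1 E2 where E: "openin (top_of_set (M - {p})) E1" "openin (top_of_set (M - {p})) E2"
     "M - {p} \<subseteq> E1 \<union> E2" "E1 \<inter> E2 = {}" "E1 \<noteq> {}" "E2 \<noteq> {}"
    unfolding connected_openin by blast
  have op: "openin (top_of_set M) (M - {p})"
    unfolding Diff_eq by (intro openin_open_Int open_Compl) simp
  have EM: "openin (top_of_set M) E1" "openin (top_of_set M) E2"
    using E op openin_trans by blast+
  have Esub: "E1 \<subseteq> M - {p}" "E2 \<subseteq> M - {p}" using E openin_imp_subset by blast+
  have "openin (top_of_set M) M" by simp
  then obtain W where W: "openin (top_of_set M) W" "p \<in> W" "connected (W - {p})"
    using punctured[OF assms, of M] assms by metis
  have WM: "W \<subseteq> M" using W openin_imp_subset by blast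
  have False if "openin (top_of_set M) F1" "openin (top_of_set M) F2" "M - {p} = F1 \<union> F2"
     "F1 \<inter> F2 = {}" "F2 \<noteq> {}" "W - {p} \<subseteq> F1" for F1 F2
  proof -
    have "openin (top_of_set M) (F1 \<union> W)" using that(1) W(1) by (rule openin_Un)
    moreover have "F1 \<union> W = insert p F1" using that(6) W(2) by blast
    moreover have "p \<notin> F2" using that(3) by blast
    then have "insert p F1 \<inter> F2 = {}" "M = insert p F1 \<union> F2" using that(3,4) assms by blast+
    ultimately show False
      using connected_openinD[OF connected_M, of "insert p F1" F2] that(2,5) by simp
  qed
  note contra = this
  obtain T1 T2 where T: "open T1" "E1 = M \<inter> T1" "open T2" "E2 = M \<inter> T2"
    using EM by (auto simp: openin_open)
  have "T1 \<inter> (W - {p}) = {} \<or> T2 \<inter> (W - {p}) = {}"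
    using W T E WM by (intro connectedD) blast+
  then have "W - {p} \<subseteq> E1 \<or> W - {p} \<subseteq> E2" using E T WM by blast
  moreover have "M - {p} = E1 \<union> E2" using E(3) Esub by blast
  ultimately show False
    using contra[OF EM _ E(4,6)] contra[OF EM(2,1) _ _ E(5)] E(4) by (metis Int_commute Un_commute)
qed

section \<open>Unstable sets of maxima by time reversal\<close>

lemma unstable_shift: "x \<in> M \<Longrightarrow> \<phi> s x \<in> unstable_set M \<phi> p \<longleftrightarrow> x \<in> unstable_set M \<phi> p"
  using gradient_like_flow.stable_shift[OF reversed, of x "- s" p]
  by (simp add: reversed_stable_set)

lemma unstable_set_maximum_open:
  "q \<in> local_maxima M f \<Longrightarrow> openin (top_of_set M) (unstable_set M \<phi> q)"
  using gradient_like_flow.stable_set_minimum_open[OF reversed, of q]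
  by (simp add: reversed_stable_set local_minima_uminus)

lemma local_maxima_rest: "local_maxima M f \<subseteq> rest"
  using gradient_like_flow.local_minima_rest[OF reversed]
  by (simp add: reversed_rest_points local_minima_uminus)

lemma unstable_unique: "x \<in> unstable_set M \<phi> p \<Longrightarrow> x \<in> unstable_set M \<phi> q \<Longrightarrow> p = q"
  using gradient_like_flow.stable_unique[OF reversed, of x p q]
  by (simp add: reversed_stable_set)

lemma rest_in_unstable: "x \<in> rest \<Longrightarrow> x \<in> unstable_set M \<phi> x"
  by (auto simp: unstable_set_def rest_points_def)

text \<open>The reversed flow traps \<open>V\<close>, and continuity of the time maps carries the
  invariance over to the closure.\<close>

lemma maximum_trapping_nbhd:
  assumes q: "q \<in> local_maxima M f" and U: "openin (top_of_set M) U" "q \<in> U"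
  obtains V where "openin (top_of_set M) V" "q \<in> V" "closure V \<subseteq> U"
    "\<And>x t. x \<in> closure V \<Longrightarrow> t \<ge> 0 \<Longrightarrow> \<phi> (- t) x \<in> closure V"
proof -
  have "q \<in> local_minima M (\<lambda>x. - f x)" using q by (simp add: local_minima_uminus)
  then obtain V where V: "openin (top_of_set M) V" "q \<in> V" "closure V \<subseteq> U"
     "V \<subseteq> stable_set M (\<lambda>t. \<phi> (- t)) q" "\<And>x t. x \<in> V \<Longrightarrow> t \<ge> 0 \<Longrightarrow> \<phi> (- t) x \<in> V"
    by (rule gradient_like_flow.trapping_nbhd[OF reversed _ U]) blast
  have sub: "closure V \<subseteq> M" using V(3) U(1) openin_imp_subset by blast
  have "\<phi> (- t) ` closure V \<subseteq> closure V" if "t \<ge> 0" for t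
    using V(5) that closure_subset
    by (intro image_closure_subset continuous_on_subset[OF flow_cont sub]) auto
  then show thesis using that[OF V(1-3)] by blast
qed

text \<open>If all orbits leaving the maximum \<open>q\<close> end in the single minimum \<open>p\<close>, then \<open>p\<close> is the only
  boundary point of \<open>unstable_set M \<phi> q\<close>, which therefore is all of \<open>M - {p}\<close>: the flow is that of
  a height function on the sphere.\<close>

lemma unstable_set_of_maximum_eq_punctured_M:
  assumes q: "q \<in> local_maxima M f" and p: "p \<in> local_minima M f"
    and D: "openin (top_of_set M) D" "q \<in> D" "D - {q} \<subseteq> stable_set M \<phi> p"
  shows "M - {p} = unstable_set M \<phi> q"
proof -
  let ?U = "unstable_set M \<phi> q"
  have qM: "q \<in> M" and pM: "p \<in> M" using q p local_maxima_rest local_minima_rest restD by blast+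
  have qU: "q \<in> ?U" using q local_maxima_rest rest_in_unstable by blast
  have UM: "?U \<subseteq> M" by (auto simp: unstable_set_def)
  have "p \<noteq> q" using p q minima_not_maxima by blast
  have pU: "p \<notin> ?U"
    using p local_minima_rest rest_in_unstable[of p] unstable_unique[of p p q] \<open>p \<noteq> q\<close> by blast
  have Uo: "openin (top_of_set M) ?U" using q by (rule unstable_set_maximum_open)
  obtain O' where O': "openin (top_of_set M) O'" "q \<in> O'" "closure O' \<subseteq> D \<inter> ?U"
     "\<And>x t. x \<in> closure O' \<Longrightarrow> t \<ge> 0 \<Longrightarrow> \<phi> (- t) x \<in> closure O'"
    using maximum_trapping_nbhd[OF q openin_Int[OF D(1) Uo]] D(2) qU by blast
  have DM: "D \<subseteq> M" using D(1) openin_imp_subset by blast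
  have cO: "compact (closure O')"
    using compact_Int_closed[OF compact_M closed_closure, of O'] O'(3) DM by (simp add: Int_absorb1 subset_iff inf_absorb2)
  obtain O1 where O1: "open O1" "O' = M \<inter> O1" using O'(1) by (rule relatively_openE)
  \<comment> \<open>The compact shell around \<open>q\<close>: the frontier of \<open>O'\<close> in
    \<open>M\<close>. It lies in \<open>D - {q}\<close>, so all its orbits end in
    \<open>p\<close>.\<close>
  define S where "S = closure O' - O1"
  have cS: "compact S" unfolding S_def using cO O1 by (intro compact_diff)
  have S_stable: "S \<subseteq> stable_set M \<phi> p"
    using O' O1 D DM unfolding S_def by blast
  \<comment> \<open>To keep a given \<open>y\<close> away from \<open>?U\<close>, this set is
    covered by a trapping neighbourhood \<open>V\<close> of \<open>p\<close> whose closure misses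
    \<open>y\<close> and by a compact subset \<open>K\<close> of \<open>?U\<close>.\<close>
  have U_open_away: "\<exists>N. openin (top_of_set M) N \<and> y \<in> N \<and> N \<subseteq> M - {p} - ?U"
    if y: "y \<in> M - {p} - ?U" for y
  proof -
    have "openin (top_of_set M) (M \<inter> - {y})" by (intro openin_open_Int open_Compl) simp
    moreover have "p \<in> M \<inter> - {y}" using y pM by blast
    ultimately obtain V where V: "openin (top_of_set M) V" "p \<in> V" "closure V \<subseteq> M \<inter> - {y}"
       "V \<subseteq> stable_set M \<phi> p" "\<And>x t. x \<in> V \<Longrightarrow> t \<ge> 0 \<Longrightarrow> \<phi> t x \<in> V"
      using trapping_nbhd[OF p] by metis
    have "\<exists>T. open T \<and> M \<inter> \<phi> (real n) -` V = M \<inter> T" for n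
      using flow_preimage_open[OF V(1), of "real n"] unfolding openin_open by blast
    then obtain T where T: "\<And>n. open (T n)" "\<And>n. M \<inter> \<phi> (real n) -` V = M \<inter> T n" by metis
    have "S \<subseteq> (\<Union>n\<in>UNIV. T n)"
    proof
      fix s assume "s \<in> S"
      then have s: "s \<in> stable_set M \<phi> p" "s \<in> M" using S_stable stable_subset by blast+
      obtain t0 where t0: "\<And>t. t \<ge> t0 \<Longrightarrow> \<phi> t s \<in> V"
        using stable_set_hits_nbhd[OF s(1) V(1,2)] unfolding eventually_at_top_linorder by blast
      obtain n where "real n \<ge> t0" using real_arch_simple by blast
      then have "s \<in> M \<inter> \<phi> (real n) -` V" using s t0 by simp
      then show "s \<in> (\<Union>n\<in>UNIV. T n)" using T(2)[of n] by blast
    qed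
    then obtain C where C: "finite C" "S \<subseteq> (\<Union>n\<in>C. T n)"
      using compactE_image[OF cS, of UNIV T] T(1) by metis
    \<comment> \<open>Finitely many preimages of \<open>V\<close> cover \<open>S\<close> and
      \<open>V\<close> is forward invariant, so from time \<open>m\<close> on the whole shell is
      inside \<open>V\<close>. Inserting \<open>0\<close> keeps the maximum defined for empty
      \<open>C\<close>.\<close>
    define m where "m = real (Max (insert 0 C))"
    have m0: "m \<ge> 0" by (simp add: m_def)
    have S_into_V: "\<phi> t s \<in> V" if st: "s \<in> S" "t \<ge> m" for s t
    proof -
      have sM: "s \<in> M" using st S_stable stable_subset by blast
      obtain n where n: "n \<in> C" "s \<in> T n" using C st by blast
      then have "\<phi> (real n) s \<in> V" using T(2)[of n] sM by blast
      moreover have "real n \<le> t" using n C(1) st(2) Max_ge[of "insert 0 C" n]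
        unfolding m_def by (meson finite_insert insertCI of_nat_le_iff order_trans)
      ultimately show ?thesis
        using V(5)[of "\<phi> (real n) s" "t - real n"] flow_add[OF sM, of "t - real n" "real n"] by simp
    qed
    define K where "K = \<phi> m ` closure O'"
    have "closure O' \<subseteq> M" using O'(3) DM by blast
    then have "compact K" unfolding K_def
      by (intro compact_continuous_image cO continuous_on_subset[OF flow_cont])
    then have "closed K" by (rule compact_imp_closed)
    have KU: "K \<subseteq> ?U" unfolding K_def using O'(3) DM unstable_shift by blast
    \<comment> \<open>If going back by time \<open>m\<close> leads into \<open>closure O'\<close>,
      then \<open>w\<close> is in \<open>K\<close>. Otherwise the backward orbit, which tends to
      \<open>q\<close>, must cross the shell still further back; that crossing lies at least
      \<open>m\<close> in the past, so \<open>w\<close> is already in \<open>V\<close>.\<close>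
    have cover: "w \<in> V \<union> K" if w: "w \<in> ?U" for w
    proof (rule ccontr)
      assume n: "w \<notin> V \<union> K"
      have wM: "w \<in> M" using w UM by blast
      have notin: "\<phi> (- m) w \<notin> closure O'"
        using n flow_inverse(2)[OF wM, of m] unfolding K_def by (metis UnI2 image_eqI)
      have "q \<in> O1" using O' O1 by blast
      have "((\<lambda>t. \<phi> (- t) w) \<longlongrightarrow> q) at_top"
        using w by (simp add: unstable_set_def filterlim_at_bot_mirror)
      then have "\<forall>\<^sub>F t in at_top. \<phi> (- t) w \<in> O1"
        using \<open>q \<in> O1\<close> O1(1) topological_tendstoD by blast
      then have "\<forall>\<^sub>F t in at_top. \<phi> (- t) w \<in> O1 \<and> t \<ge> m"
        using eventually_ge_at_top by (rule eventually_conj)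
      then obtain t1 where t1: "\<phi> (- t1) w \<in> O1" "t1 \<ge> m"
        unfolding eventually_at_top_linorder by blast
      define J where "J = (\<lambda>t. \<phi> (- t) w) ` {m..}"
      have "continuous_on UNIV (\<lambda>t. \<phi> (- t) w)"
        using continuous_on_compose2[OF orbit_cont[OF wM], of UNIV uminus]
        by (simp add: continuous_on_minus)
      then have "connected J" unfolding J_def
        by (intro connected_continuous_image connected_Ici) (auto intro: continuous_on_subset)
      moreover have "J \<subseteq> M" using flow_in[OF wM] by (auto simp: J_def)
      moreover have "J \<inter> S = {}"
      proof (rule ccontr)
        assume "J \<inter> S \<noteq> {}"
        then obtain t where t: "t \<ge> m" "\<phi> (- t) w \<in> S" by (auto simp: J_def)
        then have "\<phi> t (\<phi> (- t) w) \<in> V" using S_into_V by blast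
        then show False using n flow_inverse(2)[OF wM] by simp
      qed
      moreover have "O1 \<inter> - closure O' \<inter> J = {}"
        using O1(2) \<open>J \<subseteq> M\<close> closure_subset[of O'] by blast
      ultimately have "O1 \<inter> J = {} \<or> - closure O' \<inter> J = {}"
        using O1(1) by (intro connectedD) (auto simp: S_def)
      moreover have "\<phi> (- t1) w \<in> O1 \<inter> J" "\<phi> (- m) w \<in> - closure O' \<inter> J"
        using t1 notin by (auto simp: J_def)
      ultimately show False by blast
    qed
    have "openin (top_of_set M) (M \<inter> - (closure V \<union> K))"
      using \<open>closed K\<close> by (intro openin_open_Int open_Compl closed_Un closed_closure)
    moreover have "y \<in> M \<inter> - (closure V \<union> K)" using y V(3) KU by blast
    moreover have "M \<inter> - (closure V \<union> K) \<subseteq> M - {p} - ?U"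
      using cover V(2) closure_subset[of V] by blast
    ultimately show ?thesis by blast
  qed
  define R where "R = M - {p} - ?U"
  have Ro: "openin (top_of_set M) R"
    using U_open_away unfolding R_def by (subst openin_subopen) blast
  have sub: "openin (top_of_set (M - {p})) ?U" "openin (top_of_set (M - {p})) R"
    by (rule openin_subset_trans[OF Uo]; use UM pU in blast)
      (rule openin_subset_trans[OF Ro]; use R_def in blast)
  have "?U = {} \<or> R = {}"
    using connected_punctured_M[OF pM] sub UM pU
    by (intro connected_openinD[of "M - {p}"]) (auto simp: R_def)
  then show ?thesis using qU UM pU by (auto simp: R_def)
qed

text \<open>The chart-free substitute for saddles; for a Morse function on a surface
  \<open>saddles_eq\<close> shows that these are the critical points of index 1.\<close>

abbreviation "passes \<equiv> rest - local_minima M f - local_maxima M f"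

lemma maximum_in_closure_of_pass_lines:
  assumes q: "q \<in> local_maxima M f" and r: "r \<in> passes"
  shows "q \<in> closure (\<Union>r\<in>passes. stable_set M \<phi> r)"
proof (rule ccontr)
  let ?L = "\<Union>r\<in>passes. stable_set M \<phi> r"
  let ?U = "unstable_set M \<phi> q"
  assume "q \<notin> closure ?L"
  moreover have qr: "q \<in> rest" using q local_maxima_rest by blast
  then have "q \<in> ?U" "q \<in> M" using rest_in_unstable restD by blast+
  ultimately have "q \<in> ?U \<inter> (M \<inter> - closure ?L)" by blast
  moreover have op: "openin (top_of_set M) (?U \<inter> (M \<inter> - closure ?L))"
    by (intro openin_Int unstable_set_maximum_open q openin_open_Int open_Compl closed_closure)
  ultimately obtain D where D: "openin (top_of_set M) D" "q \<in> D" "D \<subseteq> ?U \<inter> (M \<inter> - closure ?L)"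
      "connected (D - {q})" "D - {q} \<noteq> {}"
    using punctured[OF \<open>q \<in> M\<close> op] by auto
  \<comment> \<open>Limits at passes are excluded by the choice of \<open>D\<close>. A limit at a
    maximum would make \<open>x\<close> a rest point in the unstable set of \<open>q\<close>, that
    is, \<open>q\<close> itself.\<close>
  have lim: "\<exists>p\<in>local_minima M f. x \<in> stable_set M \<phi> p" if x: "x \<in> D - {q}" for x
  proof -
    have "x \<in> M" using x D by blast
    then obtain p where p: "p \<in> rest" "x \<in> stable_set M \<phi> p" by (rule orbit_converges)
    have "p \<notin> passes" using p x D(3) closure_subset[of ?L] by blast
    moreover have "p \<notin> local_maxima M f"
    proof
      assume "p \<in> local_maxima M f"
      then have "x \<in> rest" using stable_set_maximum p by blast
      then have "x = q" using rest_in_unstable[of x] unstable_unique[of x x q] x D(3) by blast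
      with x show False by blast
    qed
    ultimately show ?thesis using p by blast
  qed
  obtain x0 where x0: "x0 \<in> D - {q}" using D by blast
  obtain p where p: "p \<in> local_minima M f" "x0 \<in> stable_set M \<phi> p" using lim x0 by blast
  \<comment> \<open>Stable sets of minima are open and pairwise disjoint, so a second minimum would
    split the connected punctured neighbourhood.\<close>
  define A1 where "A1 = (D - {q}) \<inter> stable_set M \<phi> p"
  define A2 where "A2 = (D - {q}) \<inter> (\<Union>p'\<in>local_minima M f - {p}. stable_set M \<phi> p')"
  have DM: "D - {q} \<subseteq> M" using D by blast
  have rel: "openin (top_of_set (D - {q})) ((D - {q}) \<inter> G)" if G: "openin (top_of_set M) G" for G
  proof -
    obtain T where "open T" "G = M \<inter> T" using G by (rule relatively_openE)
    then show ?thesis using DM unfolding openin_open by blast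
  qed
  have "openin (top_of_set (D - {q})) A1" "openin (top_of_set (D - {q})) A2"
    unfolding A1_def A2_def
    using stable_set_minimum_open p(1) by (auto intro!: rel openin_Union)
  moreover have "D - {q} = A1 \<union> A2"
    using lim unfolding A1_def A2_def by blast
  moreover have "A1 \<inter> A2 = {}"
    using stable_unique unfolding A1_def A2_def by blast
  ultimately have "A1 = {} \<or> A2 = {}" using connected_openinD[OF D(4)] by blast
  then have "D - {q} \<subseteq> stable_set M \<phi> p"
    using p(2) x0 \<open>D - {q} = A1 \<union> A2\<close> unfolding A1_def by blast
  from unstable_set_of_maximum_eq_punctured_M[OF q p(1) D(1,2) this]
  have eq: "M - {p} = ?U" .
  \<comment> \<open>The pass \<open>r\<close> would have \<open>q\<close> as backward limit, whereas
    a rest point is its own backward limit.\<close>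
  have "r \<noteq> p" "r \<noteq> q" "r \<in> rest" using r p q by blast+
  then have "r \<in> ?U" using eq restD by blast
  then show False using rest_in_unstable[OF \<open>r \<in> rest\<close>] unstable_unique \<open>r \<noteq> q\<close> by blast
qed

section \<open>Lines of the passes and the decomposition of M\<close>

definition pass_lines :: "'a set" where
  "pass_lines = M \<inter> closure (\<Union>r\<in>passes. stable_set M \<phi> r \<union> unstable_set M \<phi> r)"

lemma passes_nonempty: "pass_lines \<noteq> {} \<Longrightarrow> passes \<noteq> {}"
  unfolding pass_lines_def by (metis Int_empty_right Union_empty closure_empty image_empty)

lemma maxima_subset_pass_lines:
  assumes "passes \<noteq> {}"
  shows "local_maxima M f \<subseteq> pass_lines"
proof
  fix q assume q: "q \<in> local_maxima M f"
  obtain r where "r \<in> passes" using assms by blast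
  then have "q \<in> closure (\<Union>r\<in>passes. stable_set M \<phi> r)"
    using maximum_in_closure_of_pass_lines q by blast
  then have "q \<in> closure (\<Union>r\<in>passes. stable_set M \<phi> r \<union> unstable_set M \<phi> r)"
    by (rule closure_mono[THEN subsetD, rotated]) blast
  then show "q \<in> pass_lines" using q local_maxima_rest restD by (auto simp: pass_lines_def)
qed

text \<open>Stable and unstable sets enter the union symmetrically, so what is known about maxima
  carries over to minima.\<close>

lemma reversed_pass_lines:
  "gradient_like_flow.pass_lines M (\<lambda>x. - f x) (\<lambda>t. \<phi> (- t)) = pass_lines"
proof -
  have "rest - local_maxima M f - local_minima M f = passes" by blast
  then show ?thesis
    unfolding pass_lines_def gradient_like_flow.pass_lines_def[OF reversed]
    by (simp add: reversed_rest_points local_minima_uminus local_maxima_uminus reversed_stable_set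
        reversed_unstable_set Un_commute)
qed

lemma minima_subset_pass_lines:
  assumes "passes \<noteq> {}"
  shows "local_minima M f \<subseteq> pass_lines"
proof -
  have "local_maxima M (\<lambda>x. - f x) \<subseteq> gradient_like_flow.pass_lines M (\<lambda>x. - f x) (\<lambda>t. \<phi> (- t))"
  proof (rule gradient_like_flow.maxima_subset_pass_lines[OF reversed])
    show "rest_points M (\<lambda>t. \<phi> (- t)) - local_minima M (\<lambda>x. - f x) - local_maxima M (\<lambda>x. - f x) \<noteq> {}"
      using assms by (auto simp: reversed_rest_points local_minima_uminus local_maxima_uminus)
  qed
  then show ?thesis by (simp add: reversed_pass_lines local_maxima_uminus)
qed

lemma neumann_domain_disjoint_pass_lines:
  assumes p: "p \<in> local_minima M f" and q: "q \<in> local_maxima M f"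
  shows "neumann_domain M \<phi> p q \<inter> pass_lines = {}"
proof -
  let ?L = "\<Union>r\<in>passes. stable_set M \<phi> r \<union> unstable_set M \<phi> r"
  have "openin (top_of_set M) (neumann_domain M \<phi> p q)"
    unfolding neumann_domain_def
    by (intro openin_Int stable_set_minimum_open unstable_set_maximum_open p q)
  then obtain T where T: "open T" "neumann_domain M \<phi> p q = M \<inter> T" by (rule relatively_openE)
  have "?L \<subseteq> M" by (auto simp: stable_set_def unstable_set_def)
  moreover have "neumann_domain M \<phi> p q \<inter> ?L = {}"
    using p q stable_unique unstable_unique unfolding neumann_domain_def by blast
  ultimately have "T \<inter> ?L = {}" using T by blast
  then have "T \<inter> closure ?L = {}" using T(1) by (simp add: open_Int_closure_eq_empty)
  then show ?thesis using T unfolding pass_lines_def by blast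
qed

theorem decomposition:
  assumes "pass_lines \<noteq> {}"
  shows "M = (\<Union>p\<in>local_minima M f. \<Union>q\<in>local_maxima M f. neumann_domain M \<phi> p q) \<union> pass_lines"
proof (intro equalityI subsetI)
  fix x assume x: "x \<in> M"
  have ne: "passes \<noteq> {}" using passes_nonempty assms by blast
  obtain p where p: "p \<in> rest" "x \<in> stable_set M \<phi> p" using x by (rule orbit_converges)
  obtain q where q: "q \<in> rest" "x \<in> unstable_set M \<phi> q"
    using gradient_like_flow.orbit_converges[OF reversed x]
    by (auto simp: reversed_stable_set reversed_rest_points)
  have sub: "stable_set M \<phi> r \<union> unstable_set M \<phi> r \<subseteq> pass_lines" if "r \<in> passes" for r
    using that closure_subset[of "\<Union>r\<in>passes. stable_set M \<phi> r \<union> unstable_set M \<phi> r"]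
    unfolding pass_lines_def stable_set_def unstable_set_def by blast
  \<comment> \<open>An orbit with a maximum as forward limit or a minimum as backward limit is
    constant: these are the extrema themselves, which the line set has to absorb.\<close>
  consider "p \<in> passes \<or> q \<in> passes" | "p \<in> local_maxima M f" | "q \<in> local_minima M f"
    | "p \<in> local_minima M f" "q \<in> local_maxima M f"
    using p q by blast
  then show "x \<in> (\<Union>p\<in>local_minima M f. \<Union>q\<in>local_maxima M f. neumann_domain M \<phi> p q) \<union> pass_lines"
  proof cases
    case 1
    then show ?thesis using sub p q by blast
  next
    case 2
    then show ?thesis
      using stable_set_maximum[OF _ p(2)] maxima_subset_pass_lines[OF ne] by blast
  next
    case 3
    then have "x = q"
      using gradient_like_flow.stable_set_maximum[OF reversed, of q x] q
      by (simp add: reversed_stable_set local_maxima_uminus)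
    then show ?thesis using 3 minima_subset_pass_lines[OF ne] by blast
  next
    case 4
    then show ?thesis using p q unfolding neumann_domain_def by blast
  qed
next
  fix x assume "x \<in> (\<Union>p\<in>local_minima M f. \<Union>q\<in>local_maxima M f. neumann_domain M \<phi> p q) \<union> pass_lines"
  then show "x \<in> M" by (auto simp: pass_lines_def neumann_domain_def stable_set_def)
qed

lemma neumann_domains_disjoint:
  "disjoint_family_on (\<lambda>(p, q). neumann_domain M \<phi> p q) I"
  unfolding disjoint_family_on_def neumann_domain_def
  using stable_unique unstable_unique by (auto; blast)

end

section \<open>Integral curves on a surface\<close>

lemma openin_nbhd_eventually:
  fixes \<gamma> :: "real \<Rightarrow> 'a::topological_space"
  assumes "continuous_on UNIV \<gamma>" "range \<gamma> \<subseteq> M" "openin (top_of_set M) U" "\<gamma> t \<in> U"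
  shows "\<forall>\<^sub>F s in nhds t. \<gamma> s \<in> U"
proof -
  obtain T where T: "open T" "U = M \<inter> T" using assms(3) by (rule relatively_openE)
  have "(\<gamma> \<longlongrightarrow> \<gamma> t) (nhds t)"
    using assms(1) by (simp add: continuous_on_def tendsto_at_iff_tendsto_nhds)
  then have "\<forall>\<^sub>F s in nhds t. \<gamma> s \<in> T" using T assms(4) by (auto simp: tendsto_def)
  then show ?thesis by eventually_elim (use T assms(2) in auto)
qed

lemma continuous_on_if_locally:
  fixes f :: "'a::topological_space \<Rightarrow> 'b::topological_space"
  assumes "\<And>x. x \<in> M \<Longrightarrow> \<exists>U. openin (top_of_set M) U \<and> x \<in> U \<and> continuous_on U f"
  shows "continuous_on M f"
  unfolding continuous_on_topological
proof (intro ballI allI impI)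
  fix x B assume x: "x \<in> M" and B: "open B" "f x \<in> B"
  obtain U where U: "openin (top_of_set M) U" "x \<in> U" "continuous_on U f" using assms[OF x] by metis
  obtain T where T: "open T" "U = M \<inter> T" using U(1) by (rule relatively_openE)
  obtain A where A: "open A" "x \<in> A" "\<forall>y\<in>U. y \<in> A \<longrightarrow> f y \<in> B"
    using U(2,3) B unfolding continuous_on_topological by metis
  show "\<exists>A. open A \<and> x \<in> A \<and> (\<forall>y\<in>M. y \<in> A \<longrightarrow> f y \<in> B)"
    using T A U(2) by (intro exI[of _ "T \<inter> A"]) auto
qed

section \<open>Charts as local homeomorphisms\<close>

lemma chart_coord_param: "z \<in> chart_ran c \<Longrightarrow> coord c (param c z) = z"
  unfolding param_def by (rule f_inv_into_f)

lemma chart_param_dom: "z \<in> chart_ran c \<Longrightarrow> param c z \<in> chart_dom c"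
  unfolding param_def by (rule inv_into_into)

lemma chart_param_coord: "is_chart M c \<Longrightarrow> x \<in> chart_dom c \<Longrightarrow> param c (coord c x) = x"
  by (simp add: is_chart_def homeomorphism_def)

lemma chart_coord_continuous: "is_chart M c \<Longrightarrow> continuous_on (chart_dom c) (coord c)"
  by (simp add: is_chart_def homeomorphism_def)

lemma chart_param_continuous: "is_chart M c \<Longrightarrow> continuous_on (chart_ran c) (param c)"
  by (simp add: is_chart_def homeomorphism_def)

lemma chart_open_ran: "is_chart M c \<Longrightarrow> open (chart_ran c)"
  by (simp add: is_chart_def)

lemma chart_openin_dom: "is_chart M c \<Longrightarrow> openin (top_of_set M) (chart_dom c)"
  by (simp add: is_chart_def)

lemma chart_dom_subset: "is_chart M c \<Longrightarrow> chart_dom c \<subseteq> M"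
  by (drule chart_openin_dom) (rule openin_imp_subset)

lemma chart_preimage_open:
  assumes "is_chart M c" "open B"
  shows "openin (top_of_set M) {y \<in> chart_dom c. coord c y \<in> B}"
proof -
  have "openin (top_of_set (chart_dom c)) (chart_dom c \<inter> coord c -` B)"
    by (intro continuous_openin_preimage_gen chart_coord_continuous[OF assms(1)] assms(2))
  then have "openin (top_of_set M) (chart_dom c \<inter> coord c -` B)"
    using chart_openin_dom[OF assms(1)] by (rule openin_trans)
  moreover have "chart_dom c \<inter> coord c -` B = {y \<in> chart_dom c. coord c y \<in> B}" by blast
  ultimately show ?thesis by simp
qed

lemma chart_image_open:
  assumes c: "is_chart M c" and U: "openin (top_of_set M) U"
  shows "open (coord c ` (chart_dom c \<inter> U))"
proof -
  obtain T where T: "open T" "U = M \<inter> T" using U by (rule relatively_openE)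
  have "chart_dom c \<inter> U = chart_dom c \<inter> T" using T chart_dom_subset[OF c] by blast
  then have "openin (top_of_set (chart_dom c)) (chart_dom c \<inter> U)" using T by (simp add: openin_open_Int)
  then have "openin (top_of_set (chart_ran c)) (coord c ` (chart_dom c \<inter> U))"
    using c unfolding is_chart_def by (intro homeomorphism_imp_open_map) auto
  then show ?thesis using chart_open_ran[OF c] by (rule openin_open_trans)
qed

text \<open>The condition of \<open>neg_gradient_flow\<close> on a single orbit, for an arbitrary
  field, so that it also applies to the reversed field.\<close>

definition integral_curve ::
  "'a::topological_space set \<Rightarrow> 'a chart set \<Rightarrow> ('a chart \<Rightarrow> 'a \<Rightarrow> real^2) \<Rightarrow> (real \<Rightarrow> 'a) \<Rightarrow> bool" where
  "integral_curve M A X \<gamma> \<longleftrightarrow> continuous_on UNIV \<gamma> \<and> range \<gamma> \<subseteq> M \<and>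
     (\<forall>t. \<forall>c\<in>A. \<gamma> t \<in> chart_dom c \<longrightarrow>
        ((\<lambda>s. coord c (\<gamma> s)) has_vector_derivative X c (\<gamma> t)) (at t))"

section \<open>Translation and reversal of integral curves\<close>

lemma integral_curveD:
  assumes "integral_curve M A X \<gamma>"
  shows "continuous_on UNIV \<gamma>" "\<gamma> t \<in> M"
    "c \<in> A \<Longrightarrow> \<gamma> t \<in> chart_dom c \<Longrightarrow>
      ((\<lambda>s. coord c (\<gamma> s)) has_vector_derivative X c (\<gamma> t)) (at t)"
  using assms unfolding integral_curve_def by auto

lemma integral_curve_shift:
  assumes "integral_curve M A X \<gamma>"
  shows "integral_curve M A X (\<lambda>t. \<gamma> (t + a))"
  unfolding integral_curve_def
proof (intro conjI allI ballI impI)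
  show "continuous_on UNIV (\<lambda>t. \<gamma> (t + a))"
    by (rule continuous_on_compose2[OF integral_curveD(1)[OF assms]]) (auto intro!: continuous_intros)
  show "range (\<lambda>t. \<gamma> (t + a)) \<subseteq> M" using integral_curveD(2)[OF assms] by auto
  fix t c assume c: "c \<in> A" "\<gamma> (t + a) \<in> chart_dom c"
  have "((\<lambda>t. t + a) has_vector_derivative 1) (at t)"
    by (auto intro!: derivative_eq_intros)
  from vector_diff_chain_at[OF this integral_curveD(3)[OF assms c]] show "((\<lambda>s. coord c (\<gamma> (s + a))) has_vector_derivative X c (\<gamma> (t + a))) (at t)"
    by (simp add: o_def)
qed

lemma integral_curve_reverse:
  assumes "integral_curve M A X \<gamma>"
  shows "integral_curve M A (\<lambda>c x. - X c x) (\<lambda>t. \<gamma> (- t))"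
  unfolding integral_curve_def
proof (intro conjI allI ballI impI)
  show "continuous_on UNIV (\<lambda>t. \<gamma> (- t))"
    by (rule continuous_on_compose2[OF integral_curveD(1)[OF assms]]) (auto intro!: continuous_intros)
  show "range (\<lambda>t. \<gamma> (- t)) \<subseteq> M" using integral_curveD(2)[OF assms] by auto
  fix t c assume c: "c \<in> A" "\<gamma> (- t) \<in> chart_dom c"
  have "((\<lambda>t. - t) has_vector_derivative - 1) (at t)"
    by (auto intro!: derivative_eq_intros)
  from vector_diff_chain_at[OF this integral_curveD(3)[OF assms c]] show "((\<lambda>s. coord c (\<gamma> (- s))) has_vector_derivative - X c (\<gamma> (- t))) (at t)"
    by (simp add: o_def)
qed

text \<open>Existence of integral curves is not at issue here; the locale serves uniqueness and
  continuous dependence on the starting point.\<close>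

locale lipschitz_vector_field =
  fixes M :: "'a::t2_space set" and A :: "'a chart set" and X :: "'a chart \<Rightarrow> 'a \<Rightarrow> real^2"
  assumes charts: "c \<in> A \<Longrightarrow> is_chart M c" and cover: "(\<Union>c\<in>A. chart_dom c) = M"
    and compact_M: "compact M"
    and locally_lipschitz: "c \<in> A \<Longrightarrow> x \<in> chart_dom c \<Longrightarrow>
      \<exists>r>0. \<exists>L. cball (coord c x) r \<subseteq> chart_ran c \<and> L-lipschitz_on (cball (coord c x) r) (X c \<circ> param c)"
begin

lemma reversed: "lipschitz_vector_field M A (\<lambda>c x. - X c x)"
proof
  fix c x assume "c \<in> A" "x \<in> chart_dom c"
  then obtain r L where "r > 0" "cball (coord c x) r \<subseteq> chart_ran c"
      "L-lipschitz_on (cball (coord c x) r) (X c \<circ> param c)"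
    using locally_lipschitz by blast
  then show "\<exists>r>0. \<exists>L. cball (coord c x) r \<subseteq> chart_ran c \<and>
      L-lipschitz_on (cball (coord c x) r) ((\<lambda>x. - X c x) \<circ> param c)"
    unfolding o_def by (intro exI[of _ r] conjI exI[of _ L]) (simp_all add: o_def)
qed (use charts cover compact_M in auto)

text \<open>At speed at most \<open>K\<close> a curve covers at most \<open>r / 4\<close> up to time
  \<open>T\<close>, so from the half ball it stays within \<open>3 * r / 4\<close>. The speed bound
  is known only inside the ball, hence the argument by a first exit time \<open>t1\<close>.\<close>

lemma stays_in_chart:
  assumes c: "c \<in> A" and r: "r > 0" "cball z r \<subseteq> chart_ran c"
    and K: "\<And>w. w \<in> cball z r \<Longrightarrow> norm (X c (param c w)) \<le> K" "K * T \<le> r / 4" "K \<ge> 0"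
    and \<gamma>: "integral_curve M A X \<gamma>" "\<gamma> 0 \<in> chart_dom c" "dist z (coord c (\<gamma> 0)) < r / 2"
    and t: "0 \<le> t" "t \<le> T"
  shows "\<gamma> t \<in> chart_dom c \<and> dist z (coord c (\<gamma> t)) < r"
proof (rule ccontr)
  note c' = charts[OF c]
  define P where "P = {y \<in> chart_dom c. coord c y \<in> ball z r}"
  assume "\<not> (\<gamma> t \<in> chart_dom c \<and> dist z (coord c (\<gamma> t)) < r)"
  then have tP: "\<gamma> t \<notin> P" by (simp add: P_def)
  have "openin (top_of_set M) P" unfolding P_def by (intro chart_preimage_open c') simp
  then obtain O1 where O1: "open O1" "P = M \<inter> O1" by (rule relatively_openE)
  define B where "B = {0..T} \<inter> \<gamma> -` (- O1)"
  have \<gamma>_cont: "continuous_on S \<gamma>" for S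
    using integral_curveD(1)[OF \<gamma>(1)] by (rule continuous_on_subset) simp
  have "closed B" unfolding B_def using O1(1)
    by (intro continuous_closed_preimage \<gamma>_cont) auto
  then have "compact ({0..T} \<inter> B)" by (intro compact_Int_closed) auto
  then have "compact B" by (simp add: B_def Int_assoc[symmetric])
  moreover have "t \<in> B" using t tP O1 integral_curveD(2)[OF \<gamma>(1)] by (auto simp: B_def)
  ultimately obtain t1 where t1: "t1 \<in> B" "\<And>s. s \<in> B \<Longrightarrow> t1 \<le> s"
    using compact_attains_inf[of B] by (metis emptyE)
  have BP: "s \<in> B \<longleftrightarrow> 0 \<le> s \<and> s \<le> T \<and> \<gamma> s \<notin> P" for s
    using O1 integral_curveD(2)[OF \<gamma>(1)] by (auto simp: B_def)
  have "\<gamma> 0 \<in> P" using \<gamma> r by (simp add: P_def)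
  then have t1pos: "0 < t1" using t1(1) BP by (metis order_le_imp_less_or_eq)
  have inP: "\<gamma> s \<in> P" if "0 \<le> s" "s < t1" for s using t1 BP that by (metis less_le_trans not_le order_less_imp_le)
  \<comment> \<open>At the exit time the coordinate of \<open>\<gamma> t1\<close> carries no
    information yet. The image of a smaller closed ball is compact, hence closed in the ambient
    space, and retains the limit point inside the chart.\<close>
  define C where "C = param c ` cball z (3 * r / 4)"
  have Csub: "cball z (3 * r / 4) \<subseteq> ball z r" using r by auto
  have Cran: "cball z (3 * r / 4) \<subseteq> chart_ran c" using r by (auto intro: subsetD[OF r(2)])
  have "compact C" unfolding C_def
    by (intro compact_continuous_image continuous_on_subset[OF chart_param_continuous[OF c'] Cran]) simp
  then have "closed C" by (rule compact_imp_closed)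
  have "\<gamma> s \<in> C" if s: "0 \<le> s" "s < t1" for s
  proof -
    let ?u = "\<lambda>s. coord c (\<gamma> s)"
    have "norm (?u s - ?u 0) \<le> K * norm (s - 0)"
    proof (rule differentiable_bound[of "{0..s}" ?u "\<lambda>x h. h *\<^sub>R X c (\<gamma> x)"])
      fix x assume x: "x \<in> {0..s}"
      then have xP: "\<gamma> x \<in> P" using inP s by simp
      then have "(?u has_vector_derivative X c (\<gamma> x)) (at x)"
        by (intro integral_curveD(3)[OF \<gamma>(1) c]) (simp add: P_def)
      then show "(?u has_derivative (\<lambda>h. h *\<^sub>R X c (\<gamma> x))) (at x within {0..s})"
        unfolding has_vector_derivative_def by (rule has_derivative_at_withinI)
      have "norm (X c (param c (coord c (\<gamma> x)))) \<le> K" using xP by (intro K) (simp add: P_def)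
      moreover have "param c (coord c (\<gamma> x)) = \<gamma> x" using xP by (intro chart_param_coord[OF c']) (simp add: P_def)
      ultimately have "norm (X c (\<gamma> x)) \<le> K" by simp
      then show "onorm (\<lambda>h. h *\<^sub>R X c (\<gamma> x)) \<le> K"
        by (intro onorm_bound K(3)) (simp add: mult.commute[of K] mult_left_mono)
    qed (use s in auto)
    also have "\<dots> \<le> K * T" using s t1(1) BP K(3) by (intro mult_left_mono) auto
    finally have "dist (?u 0) (?u s) \<le> r / 4" using K(2) by (simp add: dist_norm norm_minus_commute)
    then have "dist z (?u s) \<le> 3 * r / 4" using \<gamma>(3) dist_triangle[of z "?u s" "?u 0"] by linarith
    moreover have "\<gamma> s = param c (?u s)"
      using inP[OF s] by (intro chart_param_coord[OF c', symmetric]) (simp add: P_def)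
    ultimately show ?thesis unfolding C_def by (intro image_eqI) auto
  qed
  then have "\<gamma> ` {0..<t1} \<subseteq> C" by auto
  then have "\<gamma> ` closure {0..<t1} \<subseteq> C"
    using \<open>closed C\<close> by (intro image_closure_subset \<gamma>_cont)
  then have "\<gamma> t1 \<in> C" using t1pos by (auto simp: closure_atLeastLessThan)
  moreover have "C \<subseteq> P"
    using Csub Cran chart_param_dom[of _ c] chart_coord_param[of _ c] unfolding C_def P_def by fastforce
  ultimately show False using t1(1) BP by blast
qed

text \<open>The time \<open>T\<close> and the rate \<open>E\<close> are uniform over all curves
  starting in \<open>U\<close>, as continuous dependence requires. Only forward times occur; the
  reversed field supplies the others.\<close>

definition flow_box :: "'a chart \<Rightarrow> 'a set \<Rightarrow> real \<Rightarrow> real \<Rightarrow> bool" where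
  "flow_box c U T E \<longleftrightarrow> c \<in> A \<and> openin (top_of_set M) U \<and> U \<subseteq> chart_dom c \<and> T > 0 \<and>
     (\<forall>\<gamma> t. integral_curve M A X \<gamma> \<and> \<gamma> 0 \<in> U \<and> 0 \<le> t \<and> t \<le> T \<longrightarrow> \<gamma> t \<in> chart_dom c) \<and>
     (\<forall>\<gamma> \<delta> t. integral_curve M A X \<gamma> \<and> integral_curve M A X \<delta> \<and> \<gamma> 0 \<in> U \<and> \<delta> 0 \<in> U \<and>
        0 \<le> t \<and> t \<le> T \<longrightarrow>
        norm (coord c (\<gamma> t) - coord c (\<delta> t)) \<le> exp (E * t) * norm (coord c (\<gamma> 0) - coord c (\<delta> 0)))"

lemma flow_boxD:
  assumes "flow_box c U T E"
  shows "c \<in> A" "openin (top_of_set M) U" "U \<subseteq> chart_dom c" "T > 0"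
    "integral_curve M A X \<gamma> \<Longrightarrow> \<gamma> 0 \<in> U \<Longrightarrow> 0 \<le> t \<Longrightarrow> t \<le> T \<Longrightarrow> \<gamma> t \<in> chart_dom c"
    "integral_curve M A X \<gamma> \<Longrightarrow> integral_curve M A X \<delta> \<Longrightarrow> \<gamma> 0 \<in> U \<Longrightarrow> \<delta> 0 \<in> U \<Longrightarrow>
      0 \<le> t \<Longrightarrow> t \<le> T \<Longrightarrow>
      norm (coord c (\<gamma> t) - coord c (\<delta> t)) \<le> exp (E * t) * norm (coord c (\<gamma> 0) - coord c (\<delta> 0))"
  using assms unfolding flow_box_def by simp_all

lemma flow_box_exists:
  assumes x0: "x0 \<in> M"
  obtains c U T E where "flow_box c U T E" "x0 \<in> U"
proof -
  obtain c where c: "c \<in> A" "x0 \<in> chart_dom c" using x0 cover by blast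
  note c' = charts[OF c(1)]
  define z where "z = coord c x0"
  obtain r L where r: "r > 0" "cball z r \<subseteq> chart_ran c" and L: "L-lipschitz_on (cball z r) (X c \<circ> param c)"
    using locally_lipschitz[OF c] unfolding z_def by blast
  have "bounded ((X c \<circ> param c) ` cball z r)"
    by (intro compact_imp_bounded compact_continuous_image lipschitz_on_continuous_on[OF L]) simp
  then obtain K0 where K0: "\<forall>w\<in>cball z r. norm (X c (param c w)) \<le> K0"
    unfolding bounded_iff by auto
  \<comment> \<open>A bound of at least \<open>1\<close> can be divided by in \<open>T\<close>, the
    time in which a quarter of the radius is covered.\<close>
  define K where "K = max 1 K0"
  have K: "K \<ge> 1" "\<And>w. w \<in> cball z r \<Longrightarrow> norm (X c (param c w)) \<le> K"
    using K0 by (auto simp: K_def le_max_iff_disj)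
  define T where "T = r / (4 * K)"
  have T: "T > 0" "K * T \<le> r / 4" using K(1) r by (auto simp: T_def)
  define U where "U = {y \<in> chart_dom c. coord c y \<in> ball z (r / 2)}"
  have stays: "\<gamma> t \<in> chart_dom c \<and> dist z (coord c (\<gamma> t)) < r"
    if "integral_curve M A X \<gamma>" "\<gamma> 0 \<in> U" "0 \<le> t" "t \<le> T" for \<gamma> t
    by (rule stays_in_chart[OF c(1) r K(2) T(2)]) (use that K(1) in \<open>auto simp: U_def\<close>)
  have contract: "norm (coord c (\<gamma> t) - coord c (\<delta> t)) \<le> exp (L * t) * norm (coord c (\<gamma> 0) - coord c (\<delta> 0))"
    if \<gamma>: "integral_curve M A X \<gamma>" "\<gamma> 0 \<in> U" and \<delta>: "integral_curve M A X \<delta>" "\<delta> 0 \<in> U"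
      and t: "0 \<le> t" "t \<le> T" for \<gamma> \<delta> t
  proof -
    have sol: "((\<lambda>s. coord c (\<eta> s)) has_vector_derivative (X c \<circ> param c) (coord c (\<eta> s))) (at s)"
      "coord c (\<eta> s) \<in> cball z r"
      if \<eta>: "integral_curve M A X \<eta>" "\<eta> 0 \<in> U" and s: "0 \<le> s" "s \<le> t" for \<eta> s
    proof -
      have d: "\<eta> s \<in> chart_dom c" "dist z (coord c (\<eta> s)) < r" using stays[OF \<eta>, of s] s t by auto
      show "((\<lambda>s. coord c (\<eta> s)) has_vector_derivative (X c \<circ> param c) (coord c (\<eta> s))) (at s)"
        using integral_curveD(3)[OF \<eta>(1) c(1) d(1)] chart_param_coord[OF c' d(1)] by simp
      show "coord c (\<eta> s) \<in> cball z r" using d by simp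
    qed
    show ?thesis
      by (rule lipschitz_solutions_diverge_exponentially[OF t(1) L sol(2)[OF \<gamma>] sol(1)[OF \<gamma>]
            sol(2)[OF \<delta>] sol(1)[OF \<delta>]])
  qed
  have "openin (top_of_set M) U" unfolding U_def by (intro chart_preimage_open c') simp
  moreover have "U \<subseteq> chart_dom c" by (auto simp: U_def)
  ultimately have "flow_box c U T L"
    unfolding flow_box_def using c(1) T(1) stays contract by (intro conjI allI impI) simp_all
  moreover have "x0 \<in> U" using c r by (simp add: U_def z_def)
  ultimately show thesis by (rule that)
qed

text \<open>With equal starting points the divergence bound of a flow box is zero.\<close>

lemma integral_curves_agree_nearby:
  assumes "integral_curve M A X \<gamma>" "integral_curve M A X \<delta>" "\<gamma> a = \<delta> a"
  shows "\<exists>T>0. \<forall>t\<in>{0..T}. \<gamma> (t + a) = \<delta> (t + a)"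
proof -
  let ?\<gamma> = "\<lambda>t. \<gamma> (t + a)" and ?\<delta> = "\<lambda>t. \<delta> (t + a)"
  have ic: "integral_curve M A X ?\<gamma>" "integral_curve M A X ?\<delta>"
    using assms by (auto intro: integral_curve_shift)
  have "\<gamma> a \<in> M" using integral_curveD(2)[OF assms(1)] .
  then obtain c U T E where box: "flow_box c U T E" "\<gamma> a \<in> U" by (rule flow_box_exists)
  note box_facts = flow_boxD[OF box(1)]
  have start: "?\<gamma> 0 \<in> U" "?\<delta> 0 \<in> U" using box(2) assms(3) by auto
  have "\<gamma> (t + a) = \<delta> (t + a)" if "t \<in> {0..T}" for t
  proof -
    have t: "0 \<le> t" "t \<le> T" using that by auto
    have d: "\<gamma> (t + a) \<in> chart_dom c" "\<delta> (t + a) \<in> chart_dom c"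
      using box_facts(5)[OF ic(1) start(1) t] box_facts(5)[OF ic(2) start(2) t] by simp_all
    have "coord c (\<gamma> (t + a)) = coord c (\<delta> (t + a))"
      using box_facts(6)[OF ic start t] assms(3) by simp
    then show ?thesis
      using chart_param_coord[OF charts[OF box_facts(1)]] d by metis
  qed
  then show ?thesis using box_facts(4) by blast
qed

text \<open>The times of agreement form a closed set because the space is Hausdorff, and an open one
  by the local statement for the field and its negative; the real line is connected.\<close>

lemma integral_curve_unique:
  assumes \<gamma>: "integral_curve M A X \<gamma>" and \<delta>: "integral_curve M A X \<delta>" and eq: "\<gamma> 0 = \<delta> 0"
  shows "\<gamma> t = \<delta> t"
proof -
  define E where "E = {t. \<gamma> t = \<delta> t}"
  have "closed E" unfolding E_def
    using integral_curveD(1)[OF \<gamma>] integral_curveD(1)[OF \<delta>] by (rule closed_Collect_eq)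
  moreover have "open E" unfolding open_contains_ball
  proof
    fix a assume "a \<in> E"
    then have a: "\<gamma> a = \<delta> a" by (simp add: E_def)
    obtain T1 where T1: "T1 > 0" "\<forall>t\<in>{0..T1}. \<gamma> (t + a) = \<delta> (t + a)"
      using integral_curves_agree_nearby[OF \<gamma> \<delta> a] by blast
    have "\<exists>T>0. \<forall>t\<in>{0..T}. \<gamma> (- (t + - a)) = \<delta> (- (t + - a))"
      using lipschitz_vector_field.integral_curves_agree_nearby[OF reversed
            integral_curve_reverse[OF \<gamma>] integral_curve_reverse[OF \<delta>], of "- a"] a by simp
    then obtain T2 where T2: "T2 > 0" "\<forall>t\<in>{0..T2}. \<gamma> (- (t + - a)) = \<delta> (- (t + - a))"
      by blast
    have "ball a (min T1 T2) \<subseteq> E"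
    proof
      fix s assume "s \<in> ball a (min T1 T2)"
      then have s: "\<bar>s - a\<bar> < T1" "\<bar>s - a\<bar> < T2" by (auto simp: dist_real_def abs_minus_commute)
      show "s \<in> E"
      proof (cases "s \<ge> a")
        case True
        then show ?thesis using T1(2)[rule_format, of "s - a"] s by (simp add: E_def)
      next
        case False
        then show ?thesis using T2(2)[rule_format, of "a - s"] s by (simp add: E_def)
      qed
    qed
    then show "\<exists>e>0. ball a e \<subseteq> E" using T1(1) T2(1) by (intro exI[of _ "min T1 T2"]) simp
  qed
  moreover have "0 \<in> E" using eq by (simp add: E_def)
  ultimately have "E = UNIV" using clopen[of E] by auto
  then show ?thesis by (auto simp: E_def)
qed

section \<open>Group law and continuity of the flow\<close>

lemma flow_add:
  assumes flow: "\<And>x. x \<in> M \<Longrightarrow> \<phi> 0 x = x \<and> integral_curve M A X (\<lambda>t. \<phi> t x)" and x: "x \<in> M"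
  shows "\<phi> (s + t) x = \<phi> s (\<phi> t x)"
proof -
  have "\<phi> t x \<in> M" using integral_curveD(2)[of M A X "\<lambda>t. \<phi> t x"] flow[OF x] by blast
  then show ?thesis
    using flow x integral_curve_unique[of "\<lambda>s. \<phi> (s + t) x" "\<lambda>s. \<phi> s (\<phi> t x)" s]
      integral_curve_shift[of M A X "\<lambda>t. \<phi> t x" t] by simp
qed

text \<open>Flow boxes make short time maps continuous near each point, compactness yields one time
  \<open>T0\<close> good for all of \<open>M\<close>, and a longer time map is an iterate of a short
  one.\<close>

lemma flow_continuous_nonneg:
  assumes flow: "\<And>x. x \<in> M \<Longrightarrow> \<phi> 0 x = x \<and> integral_curve M A X (\<lambda>t. \<phi> t x)" and t: "t \<ge> 0"
  shows "continuous_on M (\<phi> t)"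
proof -
  have into: "\<phi> t x \<in> M" if "x \<in> M" for x t
    using integral_curveD(2)[of M A X "\<lambda>t. \<phi> t x"] flow[OF that] by blast
  have "\<exists>O1 T. open O1 \<and> x \<in> O1 \<and> T > 0 \<and> (\<forall>t. 0 \<le> t \<longrightarrow> t \<le> T \<longrightarrow> continuous_on (M \<inter> O1) (\<phi> t))"
    if x: "x \<in> M" for x
  proof -
    obtain c U T E where box: "flow_box c U T E" "x \<in> U" using flow_box_exists[OF x] by blast
    note box_facts = flow_boxD[OF box(1)]
    have c: "c \<in> A" and U: "openin (top_of_set M) U" "x \<in> U" "U \<subseteq> chart_dom c" "T > 0"
      using box_facts box(2) by auto
    note c' = charts[OF c]
    obtain O1 where O1: "open O1" "U = M \<inter> O1" using U(1) by (rule relatively_openE)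
    have "continuous_on U (\<phi> t)" if t: "0 \<le> t" "t \<le> T" for t
    proof -
      have fl: "integral_curve M A X (\<lambda>t. \<phi> t y)" "\<phi> 0 y = y" if "y \<in> U" for y
        using flow that O1 by auto
      have d: "\<phi> t y \<in> chart_dom c" if "y \<in> U" for y
        using box_facts(5)[OF fl(1)[OF that] _ t] fl(2)[OF that] that by simp
      have bound: "norm (coord c (\<phi> t y) - coord c (\<phi> t w)) \<le> exp (E * t) * norm (coord c y - coord c w)"
        if "y \<in> U" "w \<in> U" for y w
        using box_facts(6)[OF fl(1)[OF that(1)] fl(1)[OF that(2)] _ _ t] fl(2)[OF that(1)] fl(2)[OF that(2)] that by simp
      have "continuous_on U (\<lambda>y. coord c (\<phi> t y))"
        unfolding continuous_on_def
      proof
        fix y assume y: "y \<in> U"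
        have "continuous_on U (coord c)"
          by (rule continuous_on_subset[OF chart_coord_continuous[OF c'] U(3)])
        then have "(coord c \<longlongrightarrow> coord c y) (at y within U)" using y by (simp add: continuous_on_def)
        then have "((\<lambda>w. exp (E * t) * norm (coord c w - coord c y)) \<longlongrightarrow> 0) (at y within U)"
          by (auto intro!: tendsto_eq_intros)
        moreover have "\<forall>\<^sub>F w in at y within U. norm (coord c (\<phi> t w) - coord c (\<phi> t y))
            \<le> exp (E * t) * norm (coord c w - coord c y)"
          using bound y by (auto simp: eventually_at_topological)
        ultimately have "((\<lambda>w. coord c (\<phi> t w) - coord c (\<phi> t y)) \<longlongrightarrow> 0) (at y within U)"
          by (rule Lim_null_comparison[rotated])
        then show "((\<lambda>y. coord c (\<phi> t y)) \<longlongrightarrow> coord c (\<phi> t y)) (at y within U)"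
          by (rule LIM_zero_cancel)
      qed
      then have "continuous_on U (\<lambda>y. param c (coord c (\<phi> t y)))"
        by (rule continuous_on_compose2[OF chart_param_continuous[OF c']]) (use d in auto)
      moreover have "param c (coord c (\<phi> t y)) = \<phi> t y" if "y \<in> U" for y
        using chart_param_coord[OF c' d[OF that]] .
      ultimately show ?thesis by (simp cong: continuous_on_cong)
    qed
    then show ?thesis using U O1 by (intro exI[of _ O1] exI[of _ T]) auto
  qed
  then obtain O1 T where O1: "\<And>x. x \<in> M \<Longrightarrow> open (O1 x)" "\<And>x. x \<in> M \<Longrightarrow> x \<in> O1 x" "\<And>x. x \<in> M \<Longrightarrow> T x > (0::real)"
    and cont: "\<And>x t. x \<in> M \<Longrightarrow> 0 \<le> t \<Longrightarrow> t \<le> T x \<Longrightarrow> continuous_on (M \<inter> O1 x) (\<phi> t)"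
    by metis
  have "M \<subseteq> (\<Union>x\<in>M. O1 x)" using O1(2) by auto
  then obtain C where C: "C \<subseteq> M" "finite C" "M \<subseteq> (\<Union>x\<in>C. O1 x)"
    using compactE_image[OF compact_M, of M O1] O1(1) by metis
  \<comment> \<open>The inserted \<open>1\<close> keeps the minimum defined when \<open>C\<close> is
    empty.\<close>
  define T0 where "T0 = Min (insert 1 (T ` C))"
  have T0: "T0 > 0" using C O1(3) by (auto simp: T0_def)
  have T0_le: "T0 \<le> T x" if "x \<in> C" for x using C(2) that by (auto simp: T0_def)
  have small: "continuous_on M (\<phi> t)" if t: "0 \<le> t" "t \<le> T0" for t
  proof (rule continuous_on_if_locally)
    fix x assume "x \<in> M"
    then obtain y where y: "y \<in> C" "x \<in> O1 y" using C by blast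
    then have "continuous_on (M \<inter> O1 y) (\<phi> t)" using C(1) T0_le[OF y(1)] t by (intro cont) auto
    moreover have "openin (top_of_set M) (M \<inter> O1 y)" using y C(1) by (intro openin_open_Int O1(1)) auto
    ultimately show "\<exists>U. openin (top_of_set M) U \<and> x \<in> U \<and> continuous_on U (\<phi> t)"
      using \<open>x \<in> M\<close> y(2) by blast
  qed
  obtain n where n: "t / T0 < real n" using reals_Archimedean2 by blast
  then have "n \<noteq> 0" using t T0 by (metis divide_nonneg_pos not_less of_nat_0)
  define s where "s = t / real n"
  have s: "0 \<le> s" "s \<le> T0"
    using n t T0 \<open>n \<noteq> 0\<close> by (auto simp: s_def field_simps)
  have "continuous_on M (\<phi> (real k * s))" for k
  proof (induction k)
    case 0
    have "continuous_on M (\<phi> 0) \<longleftrightarrow> continuous_on M (\<lambda>x. x)"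
      using flow by (intro continuous_on_cong) auto
    then show ?case by simp
  next
    case (Suc k)
    have "continuous_on M (\<lambda>x. \<phi> s (\<phi> (real k * s) x))"
      by (rule continuous_on_compose2[OF small[OF s] Suc]) (use into in auto)
    moreover have "\<phi> (real (Suc k) * s) x = \<phi> s (\<phi> (real k * s) x)" if "x \<in> M" for x
      using flow_add[OF flow that, of s "real k * s"] by (simp add: algebra_simps)
    ultimately show ?case by (simp cong: continuous_on_cong)
  qed
  from this[of n] show ?thesis using \<open>n \<noteq> 0\<close> by (simp add: s_def)
qed

lemma flow_continuous:
  assumes flow: "\<And>x. x \<in> M \<Longrightarrow> \<phi> 0 x = x \<and> integral_curve M A X (\<lambda>t. \<phi> t x)"
  shows "continuous_on M (\<phi> t)"
proof (cases "t \<ge> 0")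
  case False
  have "continuous_on M (\<phi> (- (- t)))"
  proof (rule lipschitz_vector_field.flow_continuous_nonneg[OF reversed, of "\<lambda>t. \<phi> (- t)"])
    show "\<phi> (- 0) x = x \<and> integral_curve M A (\<lambda>c x. - X c x) (\<lambda>t. \<phi> (- t) x)" if "x \<in> M" for x
      using flow[OF that] integral_curve_reverse[of M A X "\<lambda>t. \<phi> t x"] by simp
  qed (use False in simp)
  then show ?thesis by simp
qed (use flow_continuous_nonneg[OF flow] in simp)

end

section \<open>The gradient flow of a Morse function\<close>

lemma lipschitz_on_vec:
  fixes F :: "'a::metric_space \<Rightarrow> real^'n"
  assumes "\<And>i::'n. (L i)-lipschitz_on K (\<lambda>z. F z $ i)"
  shows "(\<Sum>i\<in>UNIV. L i)-lipschitz_on K F"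
proof (rule lipschitz_onI)
  show "0 \<le> (\<Sum>i\<in>UNIV. L i)" using lipschitz_on_nonneg[OF assms] by (intro sum_nonneg)
  fix x y assume xy: "x \<in> K" "y \<in> K"
  have "dist (F x) (F y) \<le> (\<Sum>i\<in>UNIV. \<bar>(F x - F y) $ i\<bar>)"
    unfolding dist_norm by (rule norm_le_l1_cart)
  also have "\<dots> \<le> (\<Sum>i\<in>UNIV. L i * dist x y)"
    using lipschitz_onD[OF assms xy] by (intro sum_mono) (simp add: dist_real_def)
  also have "\<dots> = (\<Sum>i\<in>UNIV. L i) * dist x y" by (simp add: sum_distrib_right)
  finally show "dist (F x) (F y) \<le> (\<Sum>i\<in>UNIV. L i) * dist x y" .
qed

lemma partials_nth: "partials F z $ i = frechet_derivative F (at z) (axis i 1)"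
  by (simp add: partials_def)

lemma has_derivative_partials:
  assumes "F differentiable (at z)"
  shows "(F has_derivative (\<lambda>h. partials F z \<bullet> h)) (at z)"
proof -
  let ?D = "frechet_derivative F (at z)"
  have D: "(F has_derivative ?D) (at z)" using assms frechet_derivative_works by blast
  have "?D h = partials F z \<bullet> h" for h
  proof -
    have "?D h = ?D (\<Sum>i\<in>UNIV. h $ i *\<^sub>R axis i 1)"
      using basis_expansion[of h] by (simp add: scalar_mult_eq_scaleR)
    also have "\<dots> = (\<Sum>i\<in>UNIV. h $ i * ?D (axis i 1))"
      using has_derivative_linear[OF D] by (simp add: linear_sum linear_scale)
    also have "\<dots> = partials F z \<bullet> h"
      by (simp add: inner_vec_def partials_nth mult.commute)
    finally show ?thesis .
  qed
  then have "?D = (\<lambda>h. partials F z \<bullet> h)" by blast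
  with D show ?thesis by simp
qed

lemma smooth_on_partials_differentiable:
  assumes "smooth_on S F" "z \<in> S"
  shows "partials F differentiable (at z)"
proof -
  have "(\<lambda>w. partials F w \<bullet> axis i 1) differentiable (at z)" for i
    unfolding cart_eq_inner_axis[symmetric] partials_nth
    by (rule smooth_on_differentiable[OF smooth_on_frechet_derivative[OF assms(1)] assms(2)])
  then show ?thesis
    by (subst differentiable_componentwise_within) (auto simp: Basis_vec_def)
qed

lemma smooth_on_partials_lipschitz:
  assumes "smooth_on S F" "compact K" "convex K" "K \<subseteq> S"
  obtains L where "L-lipschitz_on K (partials F)"
proof -
  have "\<exists>L. L-lipschitz_on K (\<lambda>z. partials F z $ i)" for i
    unfolding partials_nth
    using smooth_on_lipschitz_on[OF smooth_on_frechet_derivative[OF assms(1)] assms(2-4)] by metis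
  then obtain L where "\<And>i. (L i)-lipschitz_on K (\<lambda>z. partials F z $ i)" by metis
  then show thesis using lipschitz_on_vec that by blast
qed

lemma positive_definite_matrix_inv:
  fixes G :: "real^'n^'n"
  assumes "\<And>v. v \<noteq> 0 \<Longrightarrow> v \<bullet> (G *v v) > 0"
  shows "G *v (matrix_inv G *v p) = p"
proof -
  have "\<forall>x. G *v x = 0 \<longrightarrow> x = 0" using assms by (metis inner_zero_right less_irrefl)
  then have "invertible G" using matrix_left_invertible_ker invertible_left_inverse by blast
  then have "G ** matrix_inv G = mat 1"
    unfolding invertible_def matrix_inv_def by (rule someI2_ex) blast
  then show ?thesis by (simp add: matrix_vector_mul_assoc)
qed

locale morse_flow =
  fixes M :: "'a::t2_space set" and A :: "'a chart set" and g :: "'a metric" and f :: "'a \<Rightarrow> real"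
    and \<phi> :: "real \<Rightarrow> 'a \<Rightarrow> 'a"
  assumes atlas: "smooth_atlas M A" and compact: "compact M" and connected: "connected M"
    and metric: "riemannian_metric A g" and morse: "morse_function M A f"
    and flow: "neg_gradient_flow M A g f \<phi>"
begin

section \<open>The gradient in charts\<close>

abbreviation F :: "'a chart \<Rightarrow> real^2 \<Rightarrow> real" where "F c \<equiv> f \<circ> param c"

lemma chart: "c \<in> A \<Longrightarrow> is_chart M c"
  using atlas by (simp add: smooth_atlas_def)

lemma cover: "(\<Union>c\<in>A. chart_dom c) = M"
  using atlas by (simp add: smooth_atlas_def)

lemma chart_at: "x \<in> M \<Longrightarrow> \<exists>c\<in>A. x \<in> chart_dom c"
  using cover by blast

lemma dom_subset: "c \<in> A \<Longrightarrow> x \<in> chart_dom c \<Longrightarrow> x \<in> M"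
  using cover by blast

lemma smooth_F: "c \<in> A \<Longrightarrow> smooth_on (chart_ran c) (F c)"
  using morse by (simp add: morse_function_def smooth_function_def)

lemma F_derivative:
  "c \<in> A \<Longrightarrow> z \<in> chart_ran c \<Longrightarrow> (F c has_derivative (\<lambda>h. partials (F c) z \<bullet> h)) (at z)"
  by (intro has_derivative_partials smooth_on_differentiable[OF smooth_F])

lemma metric_pos: "c \<in> A \<Longrightarrow> x \<in> chart_dom c \<Longrightarrow> v \<noteq> 0 \<Longrightarrow> v \<bullet> (g c x *v v) > 0"
  using metric unfolding riemannian_metric_def by blast

lemma metric_gradient:
  "c \<in> A \<Longrightarrow> x \<in> chart_dom c \<Longrightarrow> g c x *v gradient g f c x = partials (F c) (coord c x)"
  unfolding gradient_def by (rule positive_definite_matrix_inv[OF metric_pos])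

lemma gradient_eq_0_iff:
  assumes "c \<in> A" "x \<in> chart_dom c"
  shows "gradient g f c x = 0 \<longleftrightarrow> partials (F c) (coord c x) = 0"
  using metric_gradient[OF assms] by (auto simp: gradient_def)

lemma flow_0: "x \<in> M \<Longrightarrow> \<phi> 0 x = x"
  using flow by (simp add: neg_gradient_flow_def)

lemma flow_integral_curve: "x \<in> M \<Longrightarrow> integral_curve M A (\<lambda>c x. - gradient g f c x) (\<lambda>t. \<phi> t x)"
  using flow unfolding neg_gradient_flow_def integral_curve_def by auto

lemma flow_in: "x \<in> M \<Longrightarrow> \<phi> t x \<in> M"
  using integral_curveD(2)[OF flow_integral_curve] .

text \<open>The gradient solves a linear system whose matrix \<open>g\<close> and right-hand side
  \<open>partials\<close> are smooth in coordinates, so \<open>lipschitz_on_solution\<close> applies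
  on a closed coordinate ball.\<close>

lemma lipschitz_gradient: "lipschitz_vector_field M A (\<lambda>c x. - gradient g f c x)"
proof
  fix c x assume c: "c \<in> A" "x \<in> chart_dom c"
  have "open (chart_ran c)" "coord c x \<in> chart_ran c" using chart_open_ran[OF chart[OF c(1)]] c(2) by auto
  then obtain r where r: "r > 0" "cball (coord c x) r \<subseteq> chart_ran c" using open_contains_cball by blast
  let ?K = "cball (coord c x) r"
  have "smooth_on (chart_ran c) (g c \<circ> param c)" using metric c(1) unfolding riemannian_metric_def by blast
  then obtain LG where LG: "LG-lipschitz_on ?K (g c \<circ> param c)"
    using smooth_on_lipschitz_on[of "chart_ran c" "g c \<circ> param c" ?K] r(2) by auto
  obtain Lp where Lp: "Lp-lipschitz_on ?K (partials (F c))"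
    by (rule smooth_on_partials_lipschitz[OF smooth_F[OF c(1)] _ _ r(2)]) auto
  have d: "param c z \<in> chart_dom c" "coord c (param c z) = z" if "z \<in> ?K" for z
    using that r(2) chart_param_dom[of z c] chart_coord_param[of z c] by auto
  have pos: "v \<bullet> ((g c \<circ> param c) z *v v) > 0" if "z \<in> ?K" "v \<noteq> 0" for z v
    using metric_pos[OF c(1) d(1)[OF that(1)] that(2)] by simp
  have eq: "(g c \<circ> param c) z *v (gradient g f c \<circ> param c) z = partials (F c) z" if "z \<in> ?K" for z
    using metric_gradient[OF c(1) d(1)[OF that]] unfolding d(2)[OF that] by simp
  obtain L where L: "L-lipschitz_on ?K (gradient g f c \<circ> param c)"
    by (rule lipschitz_on_solution[OF compact_cball LG Lp pos eq])
  then have "L-lipschitz_on ?K ((\<lambda>x. - gradient g f c x) \<circ> param c)" by (simp add: o_def)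
  then show "\<exists>r>0. \<exists>L. cball (coord c x) r \<subseteq> chart_ran c \<and>
      L-lipschitz_on (cball (coord c x) r) ((\<lambda>x. - gradient g f c x) \<circ> param c)"
    using r by (intro exI[of _ r] conjI exI[of _ L])
qed (use chart cover compact in auto)

sublocale field: lipschitz_vector_field M A "\<lambda>c x. - gradient g f c x"
  by (rule lipschitz_gradient)

lemma is_flow: "x \<in> M \<Longrightarrow> \<phi> 0 x = x \<and> integral_curve M A (\<lambda>c x. - gradient g f c x) (\<lambda>t. \<phi> t x)"
  using flow_0 flow_integral_curve by blast

text \<open>The chain rule in a chart, with the partial derivatives rewritten as \<open>g\<close>
  times the gradient: the result is minus the squared Riemannian length of the gradient.\<close>

lemma f_along_flow:
  assumes x: "x \<in> M" and c: "c \<in> A" "\<phi> t x \<in> chart_dom c"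
  shows "DERIV (\<lambda>s. f (\<phi> s x)) t :>
    - (gradient g f c (\<phi> t x) \<bullet> (g c (\<phi> t x) *v gradient g f c (\<phi> t x)))"
proof -
  let ?G = "gradient g f c (\<phi> t x)" and ?u = "\<lambda>s. coord c (\<phi> s x)"
  note ic = flow_integral_curve[OF x]
  have u: "(?u has_derivative (\<lambda>h. h *\<^sub>R (- ?G))) (at t)"
    using integral_curveD(3)[OF ic c] by (simp add: has_vector_derivative_def)
  have "?u t \<in> chart_ran c" using c by blast
  from has_derivative_compose[OF u F_derivative[OF c(1) this]]
  have "((\<lambda>s. F c (?u s)) has_derivative (\<lambda>h. partials (F c) (?u t) \<bullet> (h *\<^sub>R (- ?G)))) (at t)" .
  moreover have "(\<lambda>h. partials (F c) (?u t) \<bullet> (h *\<^sub>R (- ?G))) = (*) (- (?G \<bullet> (g c (\<phi> t x) *v ?G)))"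
    using metric_gradient[OF c] by (simp add: fun_eq_iff inner_commute)
  ultimately have D: "DERIV (\<lambda>s. F c (?u s)) t :> - (?G \<bullet> (g c (\<phi> t x) *v ?G))"
    by (simp add: has_field_derivative_def)
  \<comment> \<open>The chart expression equals \<open>f (\<phi> s x)\<close> only while the orbit
    is in the chart domain, which holds for \<open>s\<close> near \<open>t\<close>.\<close>
  have "\<forall>\<^sub>F s in nhds t. \<phi> s x \<in> chart_dom c"
    using integral_curveD(1,2)[OF ic] c(2) chart_openin_dom[OF chart[OF c(1)]]
    by (intro openin_nbhd_eventually[of "\<lambda>t. \<phi> t x" M]) auto
  then have ev: "\<forall>\<^sub>F s in nhds t. F c (?u s) = f (\<phi> s x)"
    by eventually_elim (simp add: chart_param_coord[OF chart[OF c(1)]])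
  from D show ?thesis by (rule DERIV_cong_ev[OF refl ev refl, THEN iffD1])
qed

lemma f_along_flow_0:
  assumes "c \<in> A" "x \<in> chart_dom c"
  shows "DERIV (\<lambda>s. f (\<phi> s x)) 0 :> - (gradient g f c x \<bullet> (g c x *v gradient g f c x))"
  using f_along_flow[OF dom_subset[OF assms] assms(1), of 0] flow_0[OF dom_subset[OF assms]] assms(2)
  by simp

lemma gradient_energy_nonneg:
  assumes "c \<in> A" "x \<in> chart_dom c"
  shows "gradient g f c x \<bullet> (g c x *v gradient g f c x) \<ge> 0"
    "gradient g f c x \<bullet> (g c x *v gradient g f c x) = 0 \<longleftrightarrow> gradient g f c x = 0"
  using metric_pos[OF assms, of "gradient g f c x"] by (cases "gradient g f c x = 0"; force)+

text \<open>The derivative of \<open>f\<close> along the flow does not depend on the chart in which it is computed,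
  so neither does the vanishing of the gradient.\<close>

lemma gradient_eq_0_chart_independent:
  assumes "c \<in> A" "x \<in> chart_dom c" "d \<in> A" "x \<in> chart_dom d" "gradient g f c x = 0"
  shows "gradient g f d x = 0"
proof -
  have "- (gradient g f c x \<bullet> (g c x *v gradient g f c x)) = - (gradient g f d x \<bullet> (g d x *v gradient g f d x))"
    by (rule DERIV_unique[OF f_along_flow_0[OF assms(1,2)] f_along_flow_0[OF assms(3,4)]])
  then show ?thesis using gradient_energy_nonneg(2)[of d x] assms by simp
qed

lemma critical_iff_partials:
  assumes "c \<in> A" "x \<in> chart_dom c"
  shows "frechet_derivative (F c) (at (coord c x)) = (\<lambda>v. 0) \<longleftrightarrow> partials (F c) (coord c x) = 0"
proof -
  have "coord c x \<in> chart_ran c" using assms by blast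
  then have "frechet_derivative (F c) (at (coord c x)) = (\<lambda>h. partials (F c) (coord c x) \<bullet> h)"
    using frechet_derivative_at[OF F_derivative[OF assms(1)]] by metis
  then show ?thesis by (auto simp: fun_eq_iff)
qed

lemma critical_iff:
  assumes "c \<in> A" "x \<in> chart_dom c"
  shows "x \<in> critical_points M A f \<longleftrightarrow> gradient g f c x = 0"
proof
  assume "x \<in> critical_points M A f"
  then show "gradient g f c x = 0"
    using assms critical_iff_partials gradient_eq_0_iff unfolding critical_points_def by blast
next
  assume 0: "gradient g f c x = 0"
  have "frechet_derivative (F d) (at (coord d x)) = (\<lambda>v. 0)" if "d \<in> A" "x \<in> chart_dom d" for d
    using gradient_eq_0_chart_independent[OF assms that 0] critical_iff_partials[OF that]
      gradient_eq_0_iff[OF that] by simp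
  then show "x \<in> critical_points M A f"
    using dom_subset[OF assms] unfolding critical_points_def by blast
qed

text \<open>The constant curve at a critical point is an integral curve, and by uniqueness the orbit
  coincides with it; conversely a constant orbit has zero velocity.\<close>

lemma rest_points_eq: "rest_points M \<phi> = critical_points M A f"
proof (intro equalityI subsetI)
  fix x assume x: "x \<in> rest_points M \<phi>"
  then have xM: "x \<in> M" and fixed: "\<And>t. \<phi> t x = x" by (auto simp: rest_points_def)
  obtain c where c: "c \<in> A" "x \<in> chart_dom c" using chart_at[OF xM] by blast
  have "((\<lambda>s. coord c x) has_vector_derivative - gradient g f c x) (at 0)"
    using integral_curveD(3)[OF flow_integral_curve[OF xM] c(1), of 0] c(2) fixed by simp
  then have "- gradient g f c x = 0"
    by (rule vector_derivative_unique_at) (rule has_vector_derivative_const)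
  then show "x \<in> critical_points M A f" using critical_iff[OF c] by simp
next
  fix x assume x: "x \<in> critical_points M A f"
  then have xM: "x \<in> M" by (simp add: critical_points_def)
  have "integral_curve M A (\<lambda>c x. - gradient g f c x) (\<lambda>t. x)"
    unfolding integral_curve_def using xM critical_iff x by auto
  then have "\<phi> t x = x" for t
    using field.integral_curve_unique[OF flow_integral_curve[OF xM], of "\<lambda>t. x" t] flow_0[OF xM] by simp
  then show "x \<in> rest_points M \<phi>" using xM by (simp add: rest_points_def)
qed

text \<open>The derivative is negative at time \<open>0\<close>, which forces a strict drop right
  afterwards, and it is nowhere positive, so the drop is never made up.\<close>

lemma f_decreases:
  assumes x: "x \<in> M" and n: "x \<notin> rest_points M \<phi>" and t: "t > 0"
  shows "f (\<phi> t x) < f x"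
proof -
  let ?h = "\<lambda>s. f (\<phi> s x)"
  have nonpos: "\<exists>y. DERIV ?h s :> y \<and> y \<le> 0" for s
  proof -
    obtain c where c: "c \<in> A" "\<phi> s x \<in> chart_dom c" using chart_at[OF flow_in[OF x]] by blast
    show ?thesis using f_along_flow[OF x c] gradient_energy_nonneg(1)[OF c] by (intro exI conjI) auto
  qed
  obtain c where c: "c \<in> A" "x \<in> chart_dom c" using chart_at[OF x] by blast
  have "gradient g f c x \<noteq> 0" using n critical_iff[OF c] rest_points_eq by simp
  then have "- (gradient g f c x \<bullet> (g c x *v gradient g f c x)) < 0"
    using gradient_energy_nonneg[OF c] by simp
  moreover have "DERIV ?h 0 :> - (gradient g f c x \<bullet> (g c x *v gradient g f c x))"
    by (rule f_along_flow_0[OF c])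
  ultimately obtain d where d: "d > 0" "\<forall>s>0. s < d \<longrightarrow> ?h 0 > ?h (0 + s)"
    using DERIV_neg_dec_right by blast
  define s where "s = min t (d / 2)"
  have s: "0 < s" "s < d" "s \<le> t" using d t by (auto simp: s_def)
  have "?h t \<le> ?h s" using s(3) nonpos by (rule DERIV_nonpos_imp_nonincreasing)
  moreover have "?h s < ?h 0" using d(2) s by simp
  ultimately show ?thesis using flow_0[OF x] by simp
qed

lemma f_continuous: "continuous_on M f"
proof (rule continuous_on_if_locally)
  fix x assume "x \<in> M"
  then obtain c where c: "c \<in> A" "x \<in> chart_dom c" using chart_at by blast
  note c' = chart[OF c(1)]
  have "continuous_on (chart_dom c) (\<lambda>y. F c (coord c y))"
    by (rule continuous_on_compose2[OF smooth_on_continuous_on[OF smooth_F[OF c(1)]]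
          chart_coord_continuous[OF c']]) simp
  moreover have "F c (coord c y) = f y" if "y \<in> chart_dom c" for y
    using chart_param_coord[OF c' that] by simp
  ultimately have "continuous_on (chart_dom c) f" by (simp cong: continuous_on_cong)
  then show "\<exists>U. openin (top_of_set M) U \<and> x \<in> U \<and> continuous_on U f"
    using chart_openin_dom[OF c'] c(2) by (intro exI conjI)
qed

lemma critical_point_in_chart:
  assumes x: "x \<in> critical_points M A f" and c: "c \<in> A" "x \<in> chart_dom c"
  shows "critical_point_on_plane (chart_ran c) (F c) (partials (F c)) (hessian f c x) (coord c x)"
proof
  show "open (chart_ran c)" using chart_open_ran[OF chart[OF c(1)]] .
  show z: "coord c x \<in> chart_ran c" using c by blast
  show "(F c has_derivative (\<lambda>h. partials (F c) w \<bullet> h)) (at w)" if "w \<in> chart_ran c" for w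
    using F_derivative[OF c(1) that] .
  show "(partials (F c) has_derivative (\<lambda>h. hessian f c x *v h)) (at (coord c x))"
    unfolding hessian_def
    by (rule jacobian_works[THEN iffD1, OF smooth_on_partials_differentiable[OF smooth_F[OF c(1)] z]])
  show "partials (F c) (coord c x) = 0"
    using x critical_iff[OF c] gradient_eq_0_iff[OF c] by simp
qed

text \<open>Nondegeneracy isolates a critical point, and around any other point continuity keeps the
  partial derivatives away from zero.\<close>

lemma critical_points_locally_finite:
  assumes x: "x \<in> M"
  shows "\<exists>U. openin (top_of_set M) U \<and> x \<in> U \<and> U \<inter> critical_points M A f \<subseteq> {x}"
proof -
  obtain c where c: "c \<in> A" "x \<in> chart_dom c" using chart_at[OF x] by blast
  note c' = chart[OF c(1)]
  have crit: "partials (F c) (coord c y) = 0" if "y \<in> critical_points M A f" "y \<in> chart_dom c" for y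
    using critical_iff[OF c(1) that(2)] gradient_eq_0_iff[OF c(1) that(2)] that(1) by simp
  obtain B where B: "open B" "coord c x \<in> B"
      "\<And>w. w \<in> B \<Longrightarrow> w \<in> chart_ran c \<Longrightarrow> partials (F c) w = 0 \<Longrightarrow> w = coord c x"
  proof (cases "x \<in> critical_points M A f")
    case True
    then have "det (hessian f c x) \<noteq> 0" using morse c by (simp add: morse_function_def)
    then obtain d where d: "d > 0" "\<And>w. dist (coord c x) w < d \<Longrightarrow> partials (F c) w = 0 \<Longrightarrow> w = coord c x"
      by (rule critical_point_on_plane.nondegenerate_imp_isolated[OF critical_point_in_chart[OF True c]]) blast
    show thesis by (rule that[of "ball (coord c x) d"]) (use d in auto)
  next
    case False
    then have nz: "partials (F c) (coord c x) \<noteq> 0"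
      using critical_iff[OF c] gradient_eq_0_iff[OF c] by simp
    have "continuous_on (chart_ran c) (partials (F c))"
      unfolding partials_def
      by (intro continuous_on_vec_lambda smooth_on_continuous_on[OF smooth_on_frechet_derivative] smooth_F c)
    then have "open (chart_ran c \<inter> partials (F c) -` (- {0}))"
      using chart_open_ran[OF c'] by (intro continuous_open_preimage) auto
    then show thesis
      by (rule that) (use nz c in auto)
  qed
  define U where "U = {y \<in> chart_dom c. coord c y \<in> B}"
  have "y = x" if y: "y \<in> U" "y \<in> critical_points M A f" for y
  proof -
    have "y \<in> chart_dom c" "coord c y \<in> B" using y by (auto simp: U_def)
    then have "coord c y = coord c x" using B(3) crit[OF y(2)] by blast
    then show ?thesis using chart_param_coord[OF c'] \<open>y \<in> chart_dom c\<close> c(2) by metis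
  qed
  then have "U \<inter> critical_points M A f \<subseteq> {x}" by blast
  moreover have "openin (top_of_set M) U" unfolding U_def by (rule chart_preimage_open[OF c' B(1)])
  moreover have "x \<in> U" using B(2) c by (simp add: U_def)
  ultimately show ?thesis by (intro exI conjI)
qed

lemma finite_critical_points: "finite (critical_points M A f)"
proof -
  have "\<exists>T. open T \<and> x \<in> T \<and> T \<inter> critical_points M A f \<subseteq> {x}" if x: "x \<in> M" for x
  proof -
    obtain U where U: "openin (top_of_set M) U" "x \<in> U" "U \<inter> critical_points M A f \<subseteq> {x}"
      using critical_points_locally_finite[OF x] by metis
    obtain T where T: "open T" "U = M \<inter> T" using U(1) by (rule relatively_openE)
    have "critical_points M A f \<subseteq> M" by (auto simp: critical_points_def)
    then have "T \<inter> critical_points M A f \<subseteq> {x}" using U(3) T(2) by blast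
    then show ?thesis using T U(2) by (intro exI[of _ T]) simp
  qed
  then obtain T where T: "\<And>x. x \<in> M \<Longrightarrow> open (T x)" "\<And>x. x \<in> M \<Longrightarrow> x \<in> T x"
    "\<And>x. x \<in> M \<Longrightarrow> T x \<inter> critical_points M A f \<subseteq> {x}" by metis
  have "M \<subseteq> (\<Union>x\<in>M. T x)" using T(2) by auto
  then obtain C where C: "C \<subseteq> M" "finite C" "M \<subseteq> (\<Union>x\<in>C. T x)"
    using compactE_image[OF compact, of M T] T(1) by metis
  have "critical_points M A f \<subseteq> C"
  proof
    fix y assume y: "y \<in> critical_points M A f"
    then have "y \<in> M" by (simp add: critical_points_def)
    then obtain x where "x \<in> C" "y \<in> T x" using C(3) by blast
    then show "y \<in> C" using T(3)[of x] C(1) y by blast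
  qed
  then show ?thesis using C(2) finite_subset by blast
qed

text \<open>A coordinate disc inside \<open>U\<close>, punctured in the plane and carried to
  \<open>M\<close> by \<open>param\<close>.\<close>

lemma punctured_nbhd:
  assumes x: "x \<in> M" and U: "openin (top_of_set M) U" "x \<in> U"
  shows "\<exists>W. openin (top_of_set M) W \<and> x \<in> W \<and> W \<subseteq> U \<and> connected (W - {x}) \<and> W - {x} \<noteq> {}"
proof -
  obtain c where c: "c \<in> A" "x \<in> chart_dom c" using chart_at[OF x] by blast
  note c' = chart[OF c(1)]
  define z where "z = coord c x"
  have "open (coord c ` (chart_dom c \<inter> U))" "z \<in> coord c ` (chart_dom c \<inter> U)"
    using chart_image_open[OF c' U(1)] c U(2) by (auto simp: z_def)
  then obtain e where e: "e > 0" "ball z e \<subseteq> coord c ` (chart_dom c \<inter> U)"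
    using open_contains_ball by blast
  have ran: "ball z e \<subseteq> chart_ran c" using e(2) by blast
  have xz: "param c z = x" using chart_param_coord[OF c' c(2)] by (simp add: z_def)
  define W where "W = {y \<in> chart_dom c. coord c y \<in> ball z e}"
  have "W \<subseteq> U"
  proof
    fix y assume y: "y \<in> W"
    then have "coord c y \<in> coord c ` (chart_dom c \<inter> U)" using e(2) by (auto simp: W_def)
    then obtain u where "u \<in> chart_dom c" "u \<in> U" "coord c y = coord c u" by blast
    then show "y \<in> U" using chart_param_coord[OF c'] y unfolding W_def by (metis (no_types, lifting) mem_Collect_eq)
  qed
  have W: "W - {x} = param c ` (ball z e - {z})"
  proof (intro equalityI subsetI)
    fix y assume y: "y \<in> W - {x}"
    then have p: "param c (coord c y) = y" using chart_param_coord[OF c'] by (simp add: W_def)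
    then have "coord c y \<noteq> z" using y xz by auto
    then show "y \<in> param c ` (ball z e - {z})"
      using p y by (intro image_eqI[of _ _ "coord c y"]) (auto simp: W_def)
  next
    fix y assume "y \<in> param c ` (ball z e - {z})"
    then obtain w where w: "w \<in> ball z e" "w \<noteq> z" "y = param c w" by blast
    then have "w \<in> chart_ran c" using ran by blast
    then have "y \<in> chart_dom c" "coord c y = w" using w(3) by (simp_all add: chart_param_dom chart_coord_param)
    then show "y \<in> W - {x}" using w by (auto simp: W_def z_def)
  qed
  \<comment> \<open>Removing a point can disconnect a convex set only in affine dimension 1.\<close>
  have aff: "aff_dim (ball z e) = 2"
    using e(1) by (simp add: aff_dim_open)
  have "connected (ball z e - {z})"
    by (rule connected_punctured_convex) (simp_all add: aff)
  then have "connected (W - {x})"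
    unfolding W using ran
    by (intro connected_continuous_image continuous_on_subset[OF chart_param_continuous[OF c']]) auto
  moreover have "W - {x} \<noteq> {}"
  proof -
    define w where "w = z + (e / 2) *\<^sub>R axis 1 1"
    have "w \<in> ball z e" "w \<noteq> z" using e(1) by (auto simp: w_def dist_norm axis_eq_0_iff)
    then show ?thesis unfolding W by blast
  qed
  moreover have "openin (top_of_set M) W" unfolding W_def by (rule chart_preimage_open[OF c']) simp
  moreover have "x \<in> W" using c e by (simp add: W_def z_def)
  ultimately show ?thesis using \<open>W \<subseteq> U\<close> by (intro exI conjI)
qed

section \<open>From the Morse function to the topological setting\<close>

sublocale gradient_like_flow M f \<phi>
proof
  show "compact M" "connected M" by (fact compact connected)+
  show "\<phi> (s + t) x = \<phi> s (\<phi> t x)" if "x \<in> M" for s t x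
    using is_flow that by (rule field.flow_add)
  show "continuous_on UNIV (\<lambda>t. \<phi> t x)" if "x \<in> M" for x
    using integral_curveD(1)[OF flow_integral_curve[OF that]] .
  show "continuous_on M (\<phi> t)" for t
    using is_flow by (rule field.flow_continuous)
  show "finite (rest_points M \<phi>)" using rest_points_eq finite_critical_points by simp
qed (fact flow_in flow_0 f_continuous f_decreases punctured_nbhd)+

text \<open>The factor \<open>s\<close> is \<open>1\<close> for minima and \<open>-1\<close> for maxima.\<close>

lemma local_min_from_chart:
  assumes c: "c \<in> A" "x \<in> chart_dom c"
    and d: "d > 0" "\<And>w. dist (coord c x) w < d \<Longrightarrow> s * F c (coord c x) \<le> s * F c w"
  shows "x \<in> local_minima M (\<lambda>y. s * f y)"
proof -
  note c' = chart[OF c(1)]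
  define U where "U = {y \<in> chart_dom c. coord c y \<in> ball (coord c x) d}"
  have "openin (top_of_set M) U" unfolding U_def by (rule chart_preimage_open[OF c']) simp
  moreover have "x \<in> U" using c d(1) by (simp add: U_def)
  moreover have "\<forall>y\<in>U. s * f x \<le> s * f y"
  proof
    fix y assume "y \<in> U"
    then have y: "y \<in> chart_dom c" "dist (coord c x) (coord c y) < d" by (auto simp: U_def)
    then show "s * f x \<le> s * f y"
      using d(2)[OF y(2)] chart_param_coord[OF c' y(1)] chart_param_coord[OF c' c(2)] by simp
  qed
  ultimately show ?thesis using dom_subset[OF c] unfolding local_minima_def by blast
qed

lemma not_local_min_from_chart:
  assumes c: "c \<in> A" "x \<in> chart_dom c"
    and d: "\<And>e. e > 0 \<Longrightarrow> \<exists>w. dist (coord c x) w < e \<and> s * F c w < s * F c (coord c x)"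
  shows "x \<notin> local_minima M (\<lambda>y. s * f y)"
proof
  note c' = chart[OF c(1)]
  assume "x \<in> local_minima M (\<lambda>y. s * f y)"
  then obtain U where U: "openin (top_of_set M) U" "x \<in> U" "\<And>y. y \<in> U \<Longrightarrow> s * f x \<le> s * f y"
    unfolding local_minima_def by blast
  have "open (coord c ` (chart_dom c \<inter> U))" "coord c x \<in> coord c ` (chart_dom c \<inter> U)"
    using chart_image_open[OF c' U(1)] c U(2) by auto
  then obtain e where e: "e > 0" "ball (coord c x) e \<subseteq> coord c ` (chart_dom c \<inter> U)"
    using open_contains_ball by blast
  obtain w where w: "dist (coord c x) w < e" "s * F c w < s * F c (coord c x)" using d[OF e(1)] by blast
  then obtain y where y: "y \<in> chart_dom c" "y \<in> U" "w = coord c y" using e(2) by fastforce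
  then show False
    using w(2) U(3)[OF y(2)] chart_param_coord[OF c' y(1)] chart_param_coord[OF c' c(2)] by simp
qed

lemma definite_imp_extremum:
  assumes x: "x \<in> critical_points M A f" and c: "c \<in> A" "x \<in> chart_dom c"
    and det: "det (hessian f c x) > 0"
  shows "x \<in> local_minima M f \<union> local_maxima M f"
proof -
  let ?H = "hessian f c x"
  interpret critical_point_on_plane "chart_ran c" "F c" "partials (F c)" ?H "coord c x"
    by (rule critical_point_in_chart[OF x c])
  interpret neg: critical_point_on_plane "chart_ran c" "\<lambda>w. - F c w" "\<lambda>w. - partials (F c) w" "- ?H" "coord c x"
    by (rule uminus)
  \<comment> \<open>The Hessian is defined as the Jacobian of \<open>partials\<close>, so its
    symmetry is a theorem and not part of the definition.\<close>
  have "(?H *v axis 1 1) \<bullet> axis 2 1 = (?H *v axis 2 1) \<bullet> axis 1 1"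
    by (rule second_derivative_symmetric[OF S F p])
  then have "?H $ 1 $ 2 = ?H $ 2 $ 1"
    by (simp add: inner_axis matrix_vector_mul_component)
  from symmetric_matrix_2_definite[OF this det] show ?thesis
  proof
    assume "\<forall>v. v \<noteq> 0 \<longrightarrow> v \<bullet> (?H *v v) > 0"
    then obtain d where "d > 0" "\<And>w. dist (coord c x) w < d \<Longrightarrow> F c (coord c x) \<le> F c w"
      using positive_definite_imp_local_min by metis
    then have "x \<in> local_minima M (\<lambda>y. 1 * f y)" by (intro local_min_from_chart[OF c]) auto
    then show ?thesis by simp
  next
    assume "\<forall>v. v \<noteq> 0 \<longrightarrow> v \<bullet> (- ?H *v v) > 0"
    then obtain d where "d > 0" "\<And>w. dist (coord c x) w < d \<Longrightarrow> - F c (coord c x) \<le> - F c w"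
      using neg.positive_definite_imp_local_min by metis
    then have "x \<in> local_minima M (\<lambda>y. (- 1) * f y)" by (intro local_min_from_chart[OF c]) auto
    then show ?thesis by (simp add: local_minima_uminus)
  qed
qed

text \<open>Eigenvectors for a negative and a positive eigenvalue are directions that refute
  minimality and maximality. Conversely, the determinant at a nondegenerate critical point that is
  no extremum is not positive, hence negative, and this yields eigenvalues of both signs.\<close>

lemma saddles_eq: "saddles M A f = critical_points M A f - local_minima M f - local_maxima M f"
proof (intro equalityI subsetI)
  fix x assume "x \<in> saddles M A f"
  then have x: "x \<in> critical_points M A f" and
    eig: "\<And>c. c \<in> A \<Longrightarrow> x \<in> chart_dom c \<Longrightarrow>
      (\<exists>l<0. is_eigenvalue (hessian f c x) l) \<and> (\<exists>l>0. is_eigenvalue (hessian f c x) l)"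
    by (auto simp: saddles_def)
  have "x \<in> M" using x by (simp add: critical_points_def)
  then obtain c where c: "c \<in> A" "x \<in> chart_dom c" using chart_at by blast
  let ?H = "hessian f c x"
  interpret critical_point_on_plane "chart_ran c" "F c" "partials (F c)" ?H "coord c x"
    by (rule critical_point_in_chart[OF x c])
  interpret neg: critical_point_on_plane "chart_ran c" "\<lambda>w. - F c w" "\<lambda>w. - partials (F c) w" "- ?H" "coord c x"
    by (rule uminus)
  obtain l v where l: "l < 0" "v \<noteq> 0" "?H *v v = l *\<^sub>R v"
    using eig[OF c] unfolding is_eigenvalue_def by blast
  then have "v \<bullet> (?H *v v) < 0" by (simp add: mult_neg_pos)
  then have "x \<notin> local_minima M (\<lambda>y. 1 * f y)"
    using negative_direction_imp_not_local_min by (intro not_local_min_from_chart[OF c]) (metis mult_1)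
  moreover obtain l v where l: "l > 0" "v \<noteq> 0" "?H *v v = l *\<^sub>R v"
    using eig[OF c] unfolding is_eigenvalue_def by blast
  then have "v \<bullet> (- ?H *v v) < 0" by (simp add: matrix_vector_mult_minus_left)
  then have "x \<notin> local_minima M (\<lambda>y. (- 1) * f y)"
    using neg.negative_direction_imp_not_local_min
    by (intro not_local_min_from_chart[OF c]) (metis mult_minus1)
  ultimately show "x \<in> critical_points M A f - local_minima M f - local_maxima M f"
    using x by (simp add: local_minima_uminus)
next
  fix x assume x: "x \<in> critical_points M A f - local_minima M f - local_maxima M f"
  have "(\<exists>l<0. is_eigenvalue (hessian f c x) l) \<and> (\<exists>l>0. is_eigenvalue (hessian f c x) l)"
    if c: "c \<in> A" "x \<in> chart_dom c" for c
  proof (rule matrix_2_indefinite)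
    have "det (hessian f c x) \<noteq> 0" using x morse c by (simp add: morse_function_def)
    moreover have "\<not> det (hessian f c x) > 0" using definite_imp_extremum[of x c] x c by blast
    ultimately show "det (hessian f c x) < 0" by linarith
  qed
  then show "x \<in> saddles M A f" using x by (simp add: saddles_def)
qed

lemma neumann_lines_eq: "neumann_lines M A f \<phi> = pass_lines"
  by (simp add: neumann_lines_def pass_lines_def saddles_eq rest_points_eq)

end

theorem proposition1p3:
  fixes M :: "'a::t2_space set"
    and A :: "'a chart set"
    and g :: "'a metric"
    and f :: "'a \<Rightarrow> real"
    and \<phi> :: "real \<Rightarrow> 'a \<Rightarrow> 'a"
  assumes "smooth_atlas M A"
    and "compact M"
    and "connected M"
    and "orientable M A"
    and "riemannian_metric A g"
    and "morse_function M A f"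
    and "neg_gradient_flow M A g f \<phi>"
    and "neumann_lines M A f \<phi> \<noteq> {}"
  shows "M = (\<Union>p\<in>local_minima M f. \<Union>q\<in>local_maxima M f. neumann_domain M \<phi> p q)
               \<union> neumann_lines M A f \<phi> \<and>
         disjoint_family_on (\<lambda>(p, q). neumann_domain M \<phi> p q)
           (local_minima M f \<times> local_maxima M f) \<and>
         (\<forall>p\<in>local_minima M f. \<forall>q\<in>local_maxima M f.
            neumann_domain M \<phi> p q \<inter> neumann_lines M A f \<phi> = {})"
proof -
  interpret morse_flow M A g f \<phi>
    using assms by unfold_locales
  have "pass_lines \<noteq> {}" using assms(8) neumann_lines_eq by simp
  then show ?thesis
    using decomposition neumann_domains_disjoint neumann_domain_disjoint_pass_lines
    unfolding neumann_lines_eq by blast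
qed

end
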